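(* Let $\gamma$ be a $\tau$-admissible Borel probability measure on $M$. Then the (continuously extended) Bourguignon–Li–Yau map $\Psi_\gamma:\overline{X}^S_\tau\to\widehat{\mathcal O}$ is surjective.
   Context: Standing setup: $G$ connected complex semisimple Lie group, $K$ maximal compact, $\theta$ Cartan involution, $\mathfrak k=\operatorname{Lie}K$; $\tau:G\to\mathrm{SL}(V)$ irreducible with finite kernel, $\langle\cdot,\cdot\rangle$ a $K$-invariant Hermitian product; $M\subset\mathbb P(V)$ the unique closed $G$-orbit with restricted Fubini–Study form; $\Phi:M\to\mathfrak k^*$ the $K$-equivariant moment map; $\widehat{\mathcal O}$ the convex hull of $\Phi(M)$; $X=G/K$; $\overline{X}^S_\tau$ the closure of $\{[\tau(g)\tau(g)^*]:g\in G\}$ in $\mathbb P(\mathcal H(V))$ ($\mathcal H(V)$ self-adjoint endomorphisms). $\rho(g)=\exp(\tfrac12\log(g\theta(g^{-1})))$, $\Psi_\gamma(gK)=\int_M\Phi(\rho(g)x)\,d\gamma(x)$; $\gamma$ is $\tau$-admissible if $\gamma(H\cap M)=0$ for every hyperplane $H\subset\mathbb P(V)$, and then $\Psi_\gamma$ extends continuously to $\overline{X}^S_\tau$ by $\Psi_\gamma([A])=\int_M\Phi([\sqrt A v])\,d\gamma([v])$, $A\ge0$. *)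

theory Defs
  imports "HOL-Probability.Probability"
begin

text \<open>Concrete matrix model. V = complex^'n with its standard Hermitian product
  (any K-invariant Hermitian product becomes the standard one in an orthonormal basis).
  The group G is replaced by its image under tau, a subgroup of SL(V).\<close>

type_synonym 'n cmat = "complex^'n^'n"

definition cadj :: "'n::finite cmat \<Rightarrow> 'n cmat" where
  "cadj A = (\<chi> i j. cnj (A $ j $ i))"

definition mtrace :: "'n::finite cmat \<Rightarrow> complex" where
  "mtrace A = (\<Sum>i\<in>UNIV. A $ i $ i)"

definition cinner :: "complex^'n::finite \<Rightarrow> complex^'n \<Rightarrow> complex" where
  "cinner v w = (\<Sum>i\<in>UNIV. cnj (v $ i) * w $ i)"

definition cscale :: "complex \<Rightarrow> 'n::finite cmat \<Rightarrow> 'n cmat" where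
  "cscale c A = (\<chi> i j. c * A $ i $ j)"

fun mpow :: "'n::finite cmat \<Rightarrow> nat \<Rightarrow> 'n cmat" where
  "mpow X 0 = mat 1"
| "mpow X (Suc k) = X ** mpow X k"

definition mexp :: "'n::finite cmat \<Rightarrow> 'n cmat" where
  "mexp X = (\<Sum>k. (1 / fact k) *\<^sub>R mpow X k)"

definition bracket :: "'n::finite cmat \<Rightarrow> 'n cmat \<Rightarrow> 'n cmat" where
  "bracket X Y = X ** Y - Y ** X"

definition lie_alg :: "'n::finite cmat set \<Rightarrow> 'n cmat set" where
  "lie_alg G = {X. \<forall>t::real. mexp (t *\<^sub>R X) \<in> G}"

definition semisimple_lie :: "'n::finite cmat set \<Rightarrow> bool" where
  "semisimple_lie g \<longleftrightarrow>
     (\<forall>I. subspace I \<and> I \<subseteq> g \<and> (\<forall>X\<in>g. \<forall>Y\<in>I. bracket X Y \<in> I)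
          \<and> (\<forall>X\<in>I. \<forall>Y\<in>I. bracket X Y = 0) \<longrightarrow> I = {0})"

text \<open>G is (the image under tau of) a connected complex semisimple Lie group inside SL(V),
  stable under the Cartan involution g \<mapsto> (g^*)^{-1} coming from the K-invariant product.\<close>
definition cx_semisimple_group :: "'n::finite cmat set \<Rightarrow> bool" where
  "cx_semisimple_group G \<longleftrightarrow>
     mat 1 \<in> G \<and> (\<forall>g\<in>G. \<forall>h\<in>G. g ** h \<in> G) \<and> (\<forall>g\<in>G. matrix_inv g \<in> G)
     \<and> (\<forall>g\<in>G. det g = 1) \<and> closed G \<and> connected G
     \<and> (\<forall>g\<in>G. cadj g \<in> G)
     \<and> (\<forall>X\<in>lie_alg G. cscale \<i> X \<in> lie_alg G)
     \<and> semisimple_lie (lie_alg G)"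

definition kalg :: "'n::finite cmat set \<Rightarrow> 'n cmat set" where
  "kalg G = {X \<in> lie_alg G. cadj X = - X}"

definition complex_subspace :: "(complex^'n::finite) set \<Rightarrow> bool" where
  "complex_subspace W \<longleftrightarrow> 0 \<in> W \<and> (\<forall>c u v. u \<in> W \<longrightarrow> v \<in> W \<longrightarrow> c *s u + v \<in> W)"

definition irreducible_rep :: "'n::finite cmat set \<Rightarrow> bool" where
  "irreducible_rep G \<longleftrightarrow>
     (\<forall>W. complex_subspace W \<and> (\<forall>g\<in>G. \<forall>v\<in>W. g *v v \<in> W) \<longrightarrow> W = {0} \<or> W = UNIV)"

text \<open>P(V) realised as the set of rank-one orthogonal projections [v] \<mapsto> v v^*/|v|^2
  (a homeomorphic embedding of P(V) into the matrices).\<close>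
definition proj_pt :: "complex^'n::finite \<Rightarrow> 'n cmat" where
  "proj_pt v = (\<chi> i j. v $ i * cnj (v $ j) / cinner v v)"

definition projspace :: "'n::finite cmat set" where
  "projspace = {proj_pt v | v. v \<noteq> 0}"

text \<open>Action of a matrix B on P(V): [v] \<mapsto> [B v] (gives 0 if B v = 0).\<close>
definition pact :: "'n::finite cmat \<Rightarrow> 'n cmat \<Rightarrow> 'n cmat" where
  "pact B P = cscale (1 / mtrace (B ** P ** cadj B)) (B ** P ** cadj B)"

definition closed_orbit :: "'n::finite cmat set \<Rightarrow> 'n cmat set \<Rightarrow> bool" where
  "closed_orbit G M \<longleftrightarrow> (\<exists>P0\<in>projspace. M = {pact g P0 | g. g \<in> G}) \<and> closed M"

text \<open>Fubini--Study moment map, as a functional on k (extended by 0 outside k):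
  Phi([v])(xi) = -i <xi v, v>/|v|^2.\<close>
definition moment :: "'n::finite cmat set \<Rightarrow> 'n cmat \<Rightarrow> 'n cmat \<Rightarrow> real" where
  "moment G P = (\<lambda>\<xi>. if \<xi> \<in> kalg G then Im (mtrace (\<xi> ** P)) else 0)"

definition fconv_hull :: "('a \<Rightarrow> real) set \<Rightarrow> ('a \<Rightarrow> real) set" where
  "fconv_hull S = {\<mu>. \<exists>F c. finite F \<and> F \<subseteq> S \<and> F \<noteq> {} \<and> (\<forall>f\<in>F. c f \<ge> 0) \<and> sum c F = 1
                        \<and> \<mu> = (\<lambda>x. \<Sum>f\<in>F. c f * f x)}"

definition moment_hull :: "'n::finite cmat set \<Rightarrow> 'n cmat set \<Rightarrow> ('n cmat \<Rightarrow> real) set" where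
  "moment_hull G M = fconv_hull (moment G ` M)"

definition psd :: "'n::finite cmat \<Rightarrow> bool" where
  "psd A \<longleftrightarrow> cadj A = A \<and> (\<forall>v. Re (cinner v (A *v v)) \<ge> 0)"

definition msqrt :: "'n::finite cmat \<Rightarrow> 'n cmat" where
  "msqrt A = (THE B. psd B \<and> B ** B = A)"

text \<open>Satake compactification: closure of {[g g^*]} in P(H(V)). Points of P(H(V)) that are
  classes of positive semidefinite matrices are represented by their trace-one
  representative; this is a homeomorphism onto its image.\<close>
definition satake_closure :: "'n::finite cmat set \<Rightarrow> 'n cmat set" where
  "satake_closure G =
     closure {cscale (1 / mtrace (g ** cadj g)) (g ** cadj g) | g. g \<in> G}"

definition admissible :: "'n::finite cmat set \<Rightarrow> 'n cmat measure \<Rightarrow> bool" where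
  "admissible M \<gamma> \<longleftrightarrow> (\<forall>w. w \<noteq> 0 \<longrightarrow> measure \<gamma> (M \<inter> {P. P *v w = 0}) = 0)"

definition BLY :: "'n::finite cmat set \<Rightarrow> 'n cmat measure \<Rightarrow> 'n cmat \<Rightarrow> ('n cmat \<Rightarrow> real)" where
  "BLY G \<gamma> A = (\<lambda>\<xi>. \<integral>P. moment G (pact (msqrt A) P) \<xi> \<partial>\<gamma>)"

end

theory Submission
  imports Defs
begin

text \<open>Let \<open>S\<close> be the space of Hermitian elements of the Lie algebra and \<open>bary B\<close> the
  barycentre of the image of \<open>\<gamma>\<close> under \<open>B\<close>. A point \<open>\<mu>\<close> of the hull is pairing with a convex
  combination \<open>Q\<close> of points of \<open>M\<close>, so the equation for \<open>exp H\<close>, \<open>H \<in> S\<close>, says that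
  \<open>bary (exp H) - Q\<close> is orthogonal to \<open>S\<close>. Along \<open>t \<mapsto> exp (t H)\<close> the pairing of \<open>H\<close> with the
  barycentre is nondecreasing (log-convexity of the squared norm) and, since a hyperplane is
  \<open>\<gamma>\<close>-null, it tends to the largest eigenvalue \<open>l\<close> of \<open>H\<close>. As \<open>det (exp (t H)) = 1\<close>, \<open>l > 0\<close>
  for \<open>H \<noteq> 0\<close>, hence \<open>s (H \<bullet> Q) < l\<close> for \<open>0 \<le> s < 1\<close>; by compactness
  \<open>H \<mapsto> bary (exp H) - s Q\<close> points outwards on large spheres of \<open>S\<close>, and Brouwer's theorem
  solves the equation with \<open>s Q\<close> in place of \<open>Q\<close>. The normalised solutions accumulate at a
  positive semidefinite matrix as \<open>s\<close> tends to 1; its square lies in the Satake closure and, the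
  barycentre being continuous there by admissibility, is mapped to \<open>\<mu>\<close>.\<close>

section \<open>Self-adjoint linear flows\<close>

text \<open>Moving from \<open>w\<close> in the direction \<open>- L w\<close> changes the form by
  \<open>t\<^sup>2 * b - 2 * t * a\<close> with \<open>a = L w \<bullet> L w\<close>, which is
  negative for small \<open>t\<close> unless \<open>a = 0\<close>.\<close>

lemma psd_form_kernel:
  fixes L :: "'a::real_inner \<Rightarrow> 'a"
  assumes "linear L" and adj: "\<And>u v. L u \<bullet> v = u \<bullet> L v"
    and pos: "\<And>v. 0 \<le> v \<bullet> L v" and zero: "w \<bullet> L w = 0"
  shows "L w = 0"
proof (rule ccontr)
  assume "L w \<noteq> 0"
  define a where "a = L w \<bullet> L w"
  define b where "b = L w \<bullet> L (L w)"
  have a: "a > 0" using \<open>L w \<noteq> 0\<close> by (simp add: a_def)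
  have b: "b \<ge> 0" using pos by (simp add: b_def)
  \<comment> \<open>Small enough that \<open>t * b \<le> a\<close>; the \<open>+ 1\<close> covers
    the case \<open>b = 0\<close>.\<close>
  define t where "t = a / (b + 1)"
  have t: "t > 0" using a b by (simp add: t_def)
  have "0 \<le> (w - t *\<^sub>R L w) \<bullet> L (w - t *\<^sub>R L w)" by (rule pos)
  also have "\<dots> = t\<^sup>2 * b - 2 * t * a"
    using zero adj[of w "L w"]
    by (simp add: linear_diff[OF assms(1)] linear_scale[OF assms(1)] inner_diff_left inner_diff_right
        a_def b_def power2_eq_square inner_commute algebra_simps)
  also have "\<dots> = t * (t * b - 2 * a)" by (simp add: power2_eq_square algebra_simps)
  finally have "2 * a \<le> t * b" using t by (simp add: zero_le_mult_iff)
  also have "\<dots> \<le> a" using a b by (simp add: t_def field_simps)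
  finally show False using a by simp
qed

text \<open>Let \<open>w\<close> maximise the form on the unit sphere and \<open>l\<close> be its
  maximum. Then \<open>l - L\<close> has a nonnegative form vanishing at \<open>w\<close>, so
  \<open>psd_form_kernel\<close> puts \<open>w\<close> in its kernel.\<close>

lemma self_adjoint_max_eigenvector:
  fixes L :: "'a::euclidean_space \<Rightarrow> 'a"
  assumes "linear L" and adj: "\<And>u v. L u \<bullet> v = u \<bullet> L v"
  obtains w l where "norm w = 1" "L w = l *\<^sub>R w" "\<And>v. v \<bullet> L v \<le> l * (v \<bullet> v)"
proof -
  have bl: "bounded_linear L" using assms(1) linear_conv_bounded_linear by blast
  have cont: "continuous_on (sphere 0 1) (\<lambda>v. v \<bullet> L v)"
    by (intro continuous_intros linear_continuous_on bl)
  have "sphere (0::'a) 1 \<noteq> {}" by simp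
  then obtain w where w: "w \<in> sphere 0 1" and max: "\<And>v. v \<in> sphere 0 1 \<Longrightarrow> v \<bullet> L v \<le> w \<bullet> L w"
    using continuous_attains_sup[OF compact_sphere _ cont] by blast
  define l where "l = w \<bullet> L w"
  have nw: "norm w = 1" using w by simp
  have le: "v \<bullet> L v \<le> l * (v \<bullet> v)" for v
  proof (cases "v = 0")
    case False
    have "(v /\<^sub>R norm v) \<bullet> L (v /\<^sub>R norm v) \<le> l"
      unfolding l_def using False by (intro max) simp
    then show ?thesis
      using False by (simp add: linear_scale[OF assms(1)] dot_square_norm power2_eq_square field_simps)
  qed simp
  have "l *\<^sub>R w - L w = 0"
  proof (rule psd_form_kernel[of "\<lambda>v. l *\<^sub>R v - L v"])
    show "linear (\<lambda>v. l *\<^sub>R v - L v)"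
      using assms(1) by (intro linear_compose_sub linear_scale_self)
    show "(l *\<^sub>R u - L u) \<bullet> v = u \<bullet> (l *\<^sub>R v - L v)" for u v
      by (simp add: inner_diff_left inner_diff_right adj)
    show "0 \<le> v \<bullet> (l *\<^sub>R v - L v)" for v using le[of v] by (simp add: inner_diff_right)
    show "w \<bullet> (l *\<^sub>R w - L w) = 0"
      using nw by (simp add: inner_diff_right l_def dot_square_norm)
  qed
  then have "L w = l *\<^sub>R w" by simp
  then show thesis using that nw le by blast
qed

text \<open>Abstract version of the curve \<open>mexp (t *\<^sub>R H) *v v\<close> for Hermitian
  \<open>H\<close>, so that only the differential equation enters the estimates.\<close>

locale self_adjoint_flow =
  fixes L :: "'a::euclidean_space \<Rightarrow> 'a" and u :: "real \<Rightarrow> 'a"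
  assumes linear_L: "linear L" and adj: "\<And>x y. L x \<bullet> y = x \<bullet> L y"
    and deriv_u: "\<And>t. (u has_vector_derivative L (u t)) (at t)"
begin

lemma bounded_linear_L: "bounded_linear L"
  using linear_L linear_conv_bounded_linear by blast

lemma deriv_Lu: "((\<lambda>t. L (u t)) has_vector_derivative L (L (u t))) (at t)"
  using bounded_linear.has_vector_derivative[OF bounded_linear_L deriv_u] .

lemma deriv_inner:
  assumes "(f has_vector_derivative f') (at t)" "(g has_vector_derivative g') (at t)"
  shows "((\<lambda>t. f t \<bullet> g t) has_real_derivative (f t \<bullet> g' + f' \<bullet> g t)) (at t)"
  using has_derivative_inner[OF assms[unfolded has_vector_derivative_def]]
  unfolding has_field_derivative_def
  by (rule has_derivative_eq_rhs) (auto simp: algebra_simps)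

lemma deriv_norm: "((\<lambda>t. u t \<bullet> u t) has_real_derivative 2 * (u t \<bullet> L (u t))) (at t)"
  using deriv_inner[OF deriv_u deriv_u, of t] by (simp add: inner_commute)

lemma norm_antimono:
  assumes "\<And>v. v \<bullet> L v \<le> 0" "s \<le> t"
  shows "norm (u t) \<le> norm (u s)"
proof -
  have "u t \<bullet> u t \<le> u s \<bullet> u s"
    using assms by (intro DERIV_nonpos_imp_nonincreasing[where f="\<lambda>t. u t \<bullet> u t"])
      (auto intro!: exI deriv_norm)
  then show ?thesis by (simp add: norm_le)
qed

text \<open>By self-adjointness \<open>w \<bullet> u t\<close> solves the scalar equation
  \<open>y' = l * y\<close>.\<close>

lemma eigen_component:
  assumes "L w = l *\<^sub>R w"
  shows "w \<bullet> u t = exp (l * t) * (w \<bullet> u 0)"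
proof -
  have "((\<lambda>t. exp (- l * t) * (w \<bullet> u t)) has_real_derivative 0) (at x)" for x
  proof -
    have "((\<lambda>t. w \<bullet> u t) has_real_derivative l * (w \<bullet> u x)) (at x)"
      using deriv_inner[OF has_vector_derivative_const deriv_u, of w x] adj[of w "u x"] assms by simp
    then show ?thesis by (auto intro!: derivative_eq_intros)
  qed
  then have "exp (- l * t) * (w \<bullet> u t) = exp (- l * 0) * (w \<bullet> u 0)"
    using DERIV_isconst_all by blast
  then show ?thesis by (simp add: exp_minus field_simps)
qed

context
  assumes nonzero: "\<And>t. u t \<noteq> 0"
begin

definition rayleigh :: "real \<Rightarrow> real" where
  "rayleigh t = (u t \<bullet> L (u t)) / (u t \<bullet> u t)"

text \<open>The numerator of the derivative is twice the Cauchy-Schwarz defect of \<open>u x\<close>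
  and \<open>L (u x)\<close>.\<close>

lemma rayleigh_mono:
  assumes "s \<le> t"
  shows "rayleigh s \<le> rayleigh t"
  using assms
proof (rule DERIV_nonneg_imp_nondecreasing)
  fix x
  let ?n = "u x \<bullet> u x" and ?m = "u x \<bullet> L (u x)" and ?q = "L (u x) \<bullet> L (u x)"
  have n: "?n > 0" using nonzero by simp
  have "(rayleigh has_real_derivative ((2 * ?q) * ?n - ?m * (2 * ?m)) / (?n * ?n)) (at x)"
    unfolding rayleigh_def[abs_def]
    using DERIV_divide[OF deriv_inner[OF deriv_u deriv_Lu] deriv_norm, of x] n adj[of "u x" "L (u x)"]
    by simp
  moreover have "?m * ?m \<le> ?n * ?q"
    using Cauchy_Schwarz_ineq[of "u x" "L (u x)"] by (simp add: power2_eq_square)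
  ultimately show "\<exists>y. (rayleigh has_real_derivative y) (at x) \<and> 0 \<le> y"
    using n by (intro exI conjI) (assumption, simp add: algebra_simps)
qed

text \<open>Half the derivative of the logarithm of the squared norm is the Rayleigh quotient, which is
  nondecreasing, so its value at \<open>T\<close> dominates half the mean slope over \<open>[0, T]\<close>.\<close>

lemma rayleigh_lower:
  assumes "L w = l *\<^sub>R w" "norm w = 1" "w \<bullet> u 0 \<noteq> 0" "T > 0"
  shows "l + (ln ((w \<bullet> u 0)\<^sup>2) - ln (u 0 \<bullet> u 0)) / (2 * T) \<le> rayleigh T"
proof -
  define F where "F t = ln (u t \<bullet> u t)" for t
  have "(F has_real_derivative 2 * rayleigh t) (at t)" for t
    unfolding F_def[abs_def] rayleigh_def using nonzero[of t]
    by (auto intro!: derivative_eq_intros deriv_norm simp: field_simps)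
  then obtain z where z: "0 < z" "z < T" "F T - F 0 = (T - 0) * (2 * rayleigh z)"
    using MVT2[of 0 T F "\<lambda>t. 2 * rayleigh t"] assms(4) by blast
  have "rayleigh z \<le> rayleigh T" using z by (intro rayleigh_mono) simp
  then have 1: "F T - F 0 \<le> 2 * T * rayleigh T"
    using z assms(4) by simp
  \<comment> \<open>The component along the unit vector \<open>w\<close> alone already makes the
    norm grow like \<open>exp (l * T)\<close>.\<close>
  have "(exp (l * T) * (w \<bullet> u 0))\<^sup>2 \<le> u T \<bullet> u T"
    using Cauchy_Schwarz_ineq[of w "u T"] assms(2) eigen_component[OF assms(1), of T]
    by (simp add: dot_square_norm)
  then have "ln ((exp (l * T) * (w \<bullet> u 0))\<^sup>2) \<le> F T"
    unfolding F_def using assms(3) by (intro ln_mono) auto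
  moreover have "ln ((exp (l * T) * (w \<bullet> u 0))\<^sup>2) = 2 * l * T + ln ((w \<bullet> u 0)\<^sup>2)"
    using assms(3) by (simp add: power_mult_distrib ln_mult flip: exp_double exp_of_nat_mult)
  ultimately have "2 * l * T + ln ((w \<bullet> u 0)\<^sup>2) - F 0 \<le> 2 * T * rayleigh T" using 1 by simp
  then show ?thesis using assms(4) by (simp add: F_def field_simps)
qed

text \<open>Squeezed between the bound of \<open>rayleigh_lower\<close>, which is \<open>l\<close>
  plus a multiple of \<open>1 / n\<close>, and the upper bound \<open>l\<close> of the form.\<close>

lemma rayleigh_tendsto:
  assumes "L w = l *\<^sub>R w" "norm w = 1" "w \<bullet> u 0 \<noteq> 0" "\<And>v. v \<bullet> L v \<le> l * (v \<bullet> v)"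
  shows "(\<lambda>n. rayleigh (real n)) \<longlonglongrightarrow> l"
proof (rule tendsto_sandwich)
  let ?c = "ln ((w \<bullet> u 0)\<^sup>2) - ln (u 0 \<bullet> u 0)"
  show "\<forall>\<^sub>F n in sequentially. l + ?c / 2 * inverse (real n) \<le> rayleigh (real n)"
    using eventually_gt_at_top[of 0]
  proof eventually_elim
    case (elim n)
    then show ?case using rayleigh_lower[OF assms(1-3), of "real n"] by (simp add: field_simps)
  qed
  show "\<forall>\<^sub>F n in sequentially. rayleigh (real n) \<le> l"
    using assms(4) nonzero by (simp add: rayleigh_def divide_le_eq)
  have "(\<lambda>n. l + ?c / 2 * inverse (real n)) \<longlonglongrightarrow> l + ?c / 2 * 0"
    by (intro tendsto_intros lim_inverse_n)
  then show "(\<lambda>n. l + ?c / 2 * inverse (real n)) \<longlonglongrightarrow> l" by simp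
qed simp

end

end

section \<open>The matrix exponential\<close>

text \<open>In finite dimension bilinear maps are bounded; this opens the limit, series and
  derivative rules of \<open>bounded_bilinear\<close> to matrix products.\<close>

lemma bounded_bilinear_matrix_mult:
  "bounded_bilinear ((**) :: 'n::finite cmat \<Rightarrow> 'n cmat \<Rightarrow> 'n cmat)"
  unfolding bilinear_conv_bounded_bilinear[symmetric] bilinear_def
  by (auto intro!: linearI simp: matrix_matrix_mult_def vec_eq_iff sum.distrib scaleR_sum_right algebra_simps)

lemma bounded_bilinear_matrix_vector_mult:
  "bounded_bilinear ((*v) :: 'n::finite cmat \<Rightarrow> complex^'n \<Rightarrow> complex^'n)"
  unfolding bilinear_conv_bounded_bilinear[symmetric] bilinear_def
  by (auto intro!: linearI simp: matrix_vector_mult_def vec_eq_iff sum.distrib scaleR_sum_right algebra_simps)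

lemma bounded_linear_cadj: "bounded_linear (cadj :: 'n::finite cmat \<Rightarrow> 'n cmat)"
  unfolding linear_conv_bounded_linear[symmetric]
  by (auto intro!: linearI simp: cadj_def vec_eq_iff)

lemma bounded_linear_mtrace: "bounded_linear (mtrace :: 'n::finite cmat \<Rightarrow> complex)"
  unfolding linear_conv_bounded_linear[symmetric]
  by (auto intro!: linearI simp: mtrace_def sum.distrib scaleR_sum_right)

lemma bounded_bilinear_cscale: "bounded_bilinear (cscale :: complex \<Rightarrow> 'n::finite cmat \<Rightarrow> 'n cmat)"
  unfolding bilinear_conv_bounded_bilinear[symmetric] bilinear_def
  by (auto intro!: linearI simp: cscale_def vec_eq_iff algebra_simps)

interpretation mm: bounded_bilinear "(**) :: 'n::finite cmat \<Rightarrow> 'n cmat \<Rightarrow> 'n cmat"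
  by (rule bounded_bilinear_matrix_mult)

interpretation mv: bounded_bilinear "(*v) :: 'n::finite cmat \<Rightarrow> complex^'n \<Rightarrow> complex^'n"
  by (rule bounded_bilinear_matrix_vector_mult)

lemmas cadj_scaleR = linear_scale[OF bounded_linear.linear[OF bounded_linear_cadj]]
lemmas mtrace_scaleR = linear_scale[OF bounded_linear.linear[OF bounded_linear_mtrace]]

interpretation cscale_map: bounded_bilinear "cscale :: complex \<Rightarrow> 'n::finite cmat \<Rightarrow> 'n cmat"
  by (rule bounded_bilinear_cscale)

lemma cadj_mult: "cadj (A ** B) = cadj B ** cadj A"
  by (simp add: cadj_def matrix_matrix_mult_def vec_eq_iff mult.commute)

lemma cadj_mat_1 [simp]: "cadj (mat 1) = mat 1"
  by (simp add: cadj_def mat_def vec_eq_iff)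

lemma inner_complex_eq_Re: "(x::complex) \<bullet> y = Re (cnj x * y)"
  by (simp add: inner_complex_def)

text \<open>Through this identity Hermitian matrices become self-adjoint real linear maps, to which
  the real Euclidean results above apply.\<close>

lemma inner_vec_eq_Re_cinner: "v \<bullet> w = Re (cinner v w)"
  by (simp add: inner_vec_def cinner_def inner_complex_eq_Re)

lemma cinner_self: "cinner v v = of_real (v \<bullet> v)"
proof -
  have "cnj z * z = of_real (z \<bullet> z)" for z
    by (simp add: complex_eq_iff inner_complex_def)
  then show ?thesis by (simp add: cinner_def inner_vec_def)
qed

lemma inner_matrix_vector_mult: "(A *v v) \<bullet> w = v \<bullet> (cadj A *v w)"
proof -
  have "cinner (A *v v) w = cinner v (cadj A *v w)"
    by (simp add: cinner_def cadj_def matrix_vector_mult_def sum_distrib_left sum_distrib_right mult.assoc)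
      (subst sum.swap, simp add: ac_simps)
  then show ?thesis by (simp add: inner_vec_eq_Re_cinner)
qed

lemma psd_iff: "psd A \<longleftrightarrow> cadj A = A \<and> (\<forall>v. 0 \<le> v \<bullet> (A *v v))"
  by (simp add: psd_def inner_vec_eq_Re_cinner)

section \<open>Powers, the Frobenius norm and convergence of the exponential series\<close>

lemma mpow_commute: "mpow X k ** X = X ** mpow X k"
  by (induction k) (simp_all add: matrix_mul_assoc[symmetric])

lemma mpow_scaleR: "mpow (t *\<^sub>R X) k = t ^ k *\<^sub>R mpow X k"
  by (induction k) (simp_all add: mm.scaleR_left mm.scaleR_right)

lemma cadj_mpow: "cadj (mpow X k) = mpow (cadj X) k"
  by (induction k) (simp_all add: cadj_mult mpow_commute)

lemma norm_matrix_power2: "(norm A)\<^sup>2 = (\<Sum>i\<in>UNIV. \<Sum>j\<in>UNIV. (cmod (A $ i $ j))\<^sup>2)"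
  by (simp add: norm_vec_def L2_set_def sum_nonneg)

text \<open>The norm is the Frobenius norm; Cauchy-Schwarz on each entry of the product, then
  summation over the entries.\<close>

lemma norm_matrix_mult_le: "norm (A ** B) \<le> norm A * norm (B::'n::finite cmat)"
proof (rule power2_le_imp_le)
  have "(cmod ((A ** B) $ i $ j))\<^sup>2 \<le> (\<Sum>k\<in>UNIV. (cmod (A $ i $ k))\<^sup>2) * (\<Sum>k\<in>UNIV. (cmod (B $ k $ j))\<^sup>2)" for i j
  proof -
    have "cmod ((A ** B) $ i $ j) \<le> (\<Sum>k\<in>UNIV. cmod (A $ i $ k) * cmod (B $ k $ j))"
      by (simp add: matrix_matrix_mult_def norm_sum flip: norm_mult)
    then have "(cmod ((A ** B) $ i $ j))\<^sup>2 \<le> (\<Sum>k\<in>UNIV. cmod (A $ i $ k) * cmod (B $ k $ j))\<^sup>2"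
      by (intro power_mono) auto
    also have "\<dots> \<le> (\<Sum>k\<in>UNIV. (cmod (A $ i $ k))\<^sup>2) * (\<Sum>k\<in>UNIV. (cmod (B $ k $ j))\<^sup>2)"
      by (rule Cauchy_Schwarz_ineq_sum)
    finally show ?thesis .
  qed
  then have "(norm (A ** B))\<^sup>2
      \<le> (\<Sum>i\<in>UNIV. \<Sum>j\<in>UNIV. (\<Sum>k\<in>UNIV. (cmod (A $ i $ k))\<^sup>2) * (\<Sum>k\<in>UNIV. (cmod (B $ k $ j))\<^sup>2))"
    unfolding norm_matrix_power2 by (intro sum_mono)
  also have "\<dots> = (norm A)\<^sup>2 * (\<Sum>j\<in>UNIV. \<Sum>k\<in>UNIV. (cmod (B $ k $ j))\<^sup>2)"
    by (simp add: norm_matrix_power2 sum_product)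
  also have "\<dots> = (norm A * norm B)\<^sup>2"
    by (subst sum.swap) (simp add: norm_matrix_power2 power_mult_distrib)
  finally show "(norm (A ** B))\<^sup>2 \<le> (norm A * norm B)\<^sup>2" .
qed simp

text \<open>The factor \<open>norm (mat 1)\<close> stays because the Frobenius norm of the identity
  is the square root of the dimension.\<close>

lemma norm_mpow_le:
  "norm (mpow (X::'n::finite cmat) k) \<le> norm X ^ k * norm (mat 1 :: 'n cmat)"
proof (induction k)
  case (Suc k)
  have "norm (mpow X (Suc k)) \<le> norm X * norm (mpow X k)"
    using norm_matrix_mult_le[of X "mpow X k"] by simp
  also have "\<dots> \<le> norm X * (norm X ^ k * norm (mat 1 :: 'n cmat))"
    using Suc.IH by (intro mult_left_mono) auto
  finally show ?case by (simp add: mult.assoc)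
qed simp

lemma summable_exp_real: "summable (\<lambda>k. (1 / fact k) * (x::real) ^ k)"
  using summable_exp[of x] by (simp add: field_simps)

lemma norm_mexp_term_le:
  assumes "norm (X::'n::finite cmat) \<le> r"
  shows "norm ((1 / fact k) *\<^sub>R mpow X k)
    \<le> (1 / fact k) * r ^ k * norm (mat 1 :: 'n cmat)"
proof -
  have "norm (mpow X k) \<le> norm X ^ k * norm (mat 1 :: 'n cmat)"
    by (rule norm_mpow_le)
  also have "\<dots> \<le> r ^ k * norm (mat 1 :: 'n cmat)"
    using assms by (intro mult_right_mono power_mono mult_left_mono) auto
  finally show ?thesis by (simp add: divide_right_mono)
qed

lemma summable_mexp: "summable (\<lambda>k. (1 / fact k) *\<^sub>R mpow (X::'n::finite cmat) k)"
  by (rule summable_comparison_test'[of _ 0, OF _ norm_mexp_term_le[OF order_refl]])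
    (intro summable_mult2 summable_exp_real)

lemma mexp_sums: "(\<lambda>k. (1 / fact k) *\<^sub>R mpow X k) sums mexp X"
  unfolding mexp_def by (rule summable_sums[OF summable_mexp])

lemma mexp_0 [simp]: "mexp (0::'n::finite cmat) = mat 1"
proof -
  have "(\<lambda>k. (1 / fact k) *\<^sub>R mpow (0::'n cmat) k) sums (\<Sum>k<1. (1 / fact k) *\<^sub>R mpow (0::'n cmat) k)"
  proof (rule sums_finite)
    fix k :: nat assume "k \<notin> {..<1}"
    then obtain j where "k = Suc j" by (cases k) auto
    then show "(1 / fact k) *\<^sub>R mpow (0::'n cmat) k = 0" by (simp add: mm.zero_left)
  qed simp
  from sums_unique2[OF mexp_sums this] show ?thesis by simp
qed

lemma mexp_commute: "X ** mexp (t *\<^sub>R X) = mexp (t *\<^sub>R X) ** X"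
proof (rule sums_unique2)
  show "(\<lambda>k. X ** ((1 / fact k) *\<^sub>R mpow (t *\<^sub>R X) k)) sums (X ** mexp (t *\<^sub>R X))"
    by (intro bounded_linear.sums[OF mm.bounded_linear_right] mexp_sums)
  have "(\<lambda>k. ((1 / fact k) *\<^sub>R mpow (t *\<^sub>R X) k) ** X) sums (mexp (t *\<^sub>R X) ** X)"
    by (intro bounded_linear.sums[OF mm.bounded_linear_left] mexp_sums)
  then show "(\<lambda>k. X ** ((1 / fact k) *\<^sub>R mpow (t *\<^sub>R X) k)) sums (mexp (t *\<^sub>R X) ** X)"
    by (simp add: mm.scaleR_left mm.scaleR_right mpow_scaleR mpow_commute)
qed

lemma cadj_mexp: "cadj (mexp X) = mexp (cadj X)"
proof (rule sums_unique2)
  show "(\<lambda>k. cadj ((1 / fact k) *\<^sub>R mpow X k)) sums cadj (mexp X)"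
    by (intro bounded_linear.sums[OF bounded_linear_cadj] mexp_sums)
  show "(\<lambda>k. cadj ((1 / fact k) *\<^sub>R mpow X k)) sums mexp (cadj X)"
    using mexp_sums[of "cadj X"] by (simp add: cadj_scaleR cadj_mpow)
qed

text \<open>The series converges uniformly on each ball by the Weierstrass test, and every point is
  interior to some ball.\<close>

lemma continuous_on_mexp: "continuous_on UNIV (mexp :: 'n::finite cmat \<Rightarrow> 'n cmat)"
proof -
  have "continuous_on (cball 0 r) (mexp :: 'n cmat \<Rightarrow> 'n cmat)" for r
  proof (rule uniform_limit_theorem)
    show "uniform_limit (cball 0 r) (\<lambda>n X. \<Sum>k<n. (1 / fact k) *\<^sub>R mpow X k) (mexp :: 'n cmat \<Rightarrow> 'n cmat) sequentially"
      unfolding mexp_def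
    proof (rule Weierstrass_m_test)
      show "norm ((1 / fact k) *\<^sub>R mpow X k) \<le> (1 / fact k) * r ^ k * norm (mat 1 :: 'n cmat)"
        if "X \<in> cball 0 r" for k and X :: "'n cmat"
        using that by (intro norm_mexp_term_le) simp
      show "summable (\<lambda>k. (1 / fact k) * r ^ k * norm (mat 1 :: 'n cmat))"
        by (intro summable_mult2 summable_exp_real)
    qed
    have "continuous_on (cball 0 r) (\<lambda>X::'n cmat. mpow X k)" for k
      by (induction k) (auto intro!: continuous_intros mm.continuous_on)
    then show "\<forall>\<^sub>F n in sequentially. continuous_on (cball 0 r) (\<lambda>X::'n cmat. \<Sum>k<n. (1 / fact k) *\<^sub>R mpow X k)"
      by (intro always_eventually allI continuous_intros)
  qed simp
  then have "isCont (mexp :: 'n cmat \<Rightarrow> 'n cmat) X" for X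
    by (rule continuous_on_interior[of "cball 0 (norm X + 1)"]) simp
  then show ?thesis by (simp add: continuous_at_imp_continuous_on)
qed

lemma tendsto_mexp: "(f \<longlongrightarrow> X) F \<Longrightarrow> ((\<lambda>x. mexp (f x)) \<longlongrightarrow> mexp X) F"
  using continuous_on_mexp continuous_on_tendsto_compose by fastforce

section \<open>Derivative and one-parameter group law of the exponential\<close>

lemma has_vector_derivative_vecI:
  assumes "\<And>i. ((\<lambda>t. f t $ i) has_vector_derivative f' $ i) (at x)"
  shows "(f has_vector_derivative f') (at x)"
  unfolding has_vector_derivative_def has_derivative_at_within
proof (intro conjI vec_tendstoI)
  show "bounded_linear (\<lambda>h. h *\<^sub>R f')" by (rule bounded_linear_scaleR_left)
  show "((\<lambda>y. ((f y - f x - (y - x) *\<^sub>R f') /\<^sub>R norm (y - x)) $ i) \<longlongrightarrow> 0 $ i) (at x)" for i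
    using assms[of i] by (simp add: has_vector_derivative_def has_derivative_at_within)
qed

text \<open>Each entry of \<open>mexp (t *\<^sub>R X)\<close> is an everywhere convergent complex
  power series in \<open>t\<close> with coefficients \<open>c\<close>, differentiated term by
  term.\<close>

lemma mexp_has_vector_derivative:
  fixes X :: "'n::finite cmat"
  shows "((\<lambda>t. mexp (t *\<^sub>R X)) has_vector_derivative X ** mexp (t *\<^sub>R X)) (at t)"
proof (intro has_vector_derivative_vecI)
  fix i j
  define c where "c k = mpow X k $ i $ j / fact k" for k
  have entry: "bounded_linear (\<lambda>A::'n cmat. A $ i $ j)"
    by (rule bounded_linear_compose[OF bounded_linear_vec_nth bounded_linear_vec_nth])
  have c: "(\<lambda>k. c k * of_real s ^ k) sums (mexp (s *\<^sub>R X) $ i $ j)" for s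
    using bounded_linear.sums[OF entry mexp_sums, of "s *\<^sub>R X"]
    by (simp add: c_def mpow_scaleR scaleR_conv_of_real[where 'a=complex] ac_simps)
  have summ: "summable (\<lambda>k. c k * z ^ k)" for z
  proof (rule powser_inside)
    show "summable (\<lambda>k. c k * of_real (norm z + 1) ^ k)" using c by (rule sums_summable)
  qed simp
  have "diffs c k = (X ** ((1 / fact k) *\<^sub>R mpow X k)) $ i $ j" for k
    by (simp add: diffs_def c_def mm.scaleR_right scaleR_conv_of_real[where 'a=complex] field_simps del: of_nat_Suc)
  moreover have "(\<lambda>k. (X ** ((1 / fact k) *\<^sub>R mpow (t *\<^sub>R X) k)) $ i $ j) sums ((X ** mexp (t *\<^sub>R X)) $ i $ j)"
    by (intro bounded_linear.sums[OF entry] bounded_linear.sums[OF mm.bounded_linear_right] mexp_sums)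
  ultimately have d: "(\<lambda>k. diffs c k * of_real t ^ k) sums ((X ** mexp (t *\<^sub>R X)) $ i $ j)"
    by (simp add: mpow_scaleR mm.scaleR_right scaleR_conv_of_real[where 'a=complex] ac_simps)
  have "((\<lambda>z. \<Sum>k. c k * z ^ k) has_field_derivative (\<Sum>k. diffs c k * of_real t ^ k)) (at (of_real t))"
    by (rule termdiffs_strong_converges_everywhere[OF summ])
  from has_vector_derivative_real_field[OF this]
  show "((\<lambda>t. mexp (t *\<^sub>R X) $ i $ j) has_vector_derivative (X ** mexp (t *\<^sub>R X)) $ i $ j) (at t)"
    using sums_unique[OF c] sums_unique[OF d] by (simp add: o_def)
qed

text \<open>With the sum \<open>r\<close> fixed, the product \<open>?f\<close> has derivative zero
  in \<open>t\<close>; compare its values at \<open>t\<close> and \<open>0\<close>.\<close>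

lemma mexp_add_scaleR: "mexp ((s + t) *\<^sub>R X) = mexp (s *\<^sub>R X) ** mexp (t *\<^sub>R X)"
proof -
  define r where "r = s + t"
  let ?f = "\<lambda>t. mexp ((r - t) *\<^sub>R X) ** mexp (t *\<^sub>R X)"
  have d: "((\<lambda>t. mexp ((r - t) *\<^sub>R X)) has_vector_derivative - (X ** mexp ((r - x) *\<^sub>R X))) (at x)" for x
  proof -
    have "((\<lambda>t. mexp (t *\<^sub>R X)) \<circ> (\<lambda>t. r - t) has_vector_derivative (-1) *\<^sub>R (X ** mexp ((r - x) *\<^sub>R X))) (at x)"
      by (rule vector_diff_chain_at[OF _ mexp_has_vector_derivative]) (auto intro!: derivative_eq_intros)
    then show ?thesis by (simp add: o_def)
  qed
  have "(?f has_derivative (\<lambda>h. 0)) (at x)" for x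
    using mm.has_vector_derivative[OF d mexp_has_vector_derivative[of X], of x]
    by (simp add: mm.minus_left mexp_commute[of X "r - x"] matrix_mul_assoc has_vector_derivative_def)
  then have "\<exists>c. \<forall>t. ?f t = c"
    using has_derivative_zero_constant[of UNIV ?f] by simp
  then have "?f t = ?f 0" by metis
  then show ?thesis by (simp add: r_def)
qed

lemma mexp_minus_cancel: "mexp (- t *\<^sub>R X) ** mexp (t *\<^sub>R X) = mat 1"
  using mexp_add_scaleR[of "-t" t X] by simp

lemma mpow_mexp: "mpow (mexp (t *\<^sub>R X)) k = mexp ((real k * t) *\<^sub>R X)"
proof (induction k)
  case (Suc k)
  then show ?case using mexp_add_scaleR[of t "real k * t" X] by (simp add: algebra_simps)
qed simp

lemma mexp_mult_vector_nonzero: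
  assumes "v \<noteq> 0"
  shows "mexp (t *\<^sub>R X) *v v \<noteq> 0"
proof
  assume "mexp (t *\<^sub>R X) *v v = 0"
  then have "mexp (- t *\<^sub>R X) *v (mexp (t *\<^sub>R X) *v v) = 0" by simp
  then show False using assms mexp_minus_cancel[of t X] by (simp only: matrix_vector_mul_assoc) simp
qed

text \<open>\<open>mexp H\<close> is the square of the Hermitian matrix \<open>?B\<close>, the
  exponential of half of \<open>H\<close>.\<close>

lemma psd_mexp:
  assumes "cadj H = H"
  shows "psd (mexp H)"
proof -
  let ?B = "mexp ((1 / 2) *\<^sub>R H)"
  have B: "cadj ?B = ?B" using assms by (simp add: cadj_mexp cadj_scaleR)
  have "mexp H = ?B ** ?B"
    using mexp_add_scaleR[of "1/2" "1/2" H] by simp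
  then have "v \<bullet> (mexp H *v v) = (?B *v v) \<bullet> (?B *v v)" for v
    by (metis B inner_matrix_vector_mult matrix_vector_mul_assoc)
  then show ?thesis using assms by (simp add: psd_iff cadj_mexp)
qed

section \<open>Projective points and positive semidefinite matrices\<close>

lemma proj_pt_nth: "proj_pt v $ i $ j = v $ i * cnj (v $ j) / of_real (v \<bullet> v)"
  by (simp add: proj_pt_def cinner_self)

lemma conj_proj_pt:
  "(B ** proj_pt v ** cadj B) $ i $ j = (B *v v) $ i * cnj ((B *v v) $ j) / of_real (v \<bullet> v)"
proof -
  have "(B ** proj_pt v ** cadj B) $ i $ j
      = (\<Sum>l\<in>UNIV. (\<Sum>k\<in>UNIV. B $ i $ k * (v $ k * cnj (v $ l) / of_real (v \<bullet> v))) * cnj (B $ j $ l))"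
    by (simp add: matrix_matrix_mult_def cadj_def proj_pt_nth)
  also have "\<dots> = (\<Sum>k\<in>UNIV. B $ i $ k * v $ k) * (\<Sum>l\<in>UNIV. cnj (B $ j $ l) * cnj (v $ l)) / of_real (v \<bullet> v)"
    unfolding sum_product sum_distrib_right
    by (subst sum.swap) (simp add: sum_divide_distrib sum_distrib_left ac_simps)
  finally show ?thesis by (simp add: matrix_vector_mult_def)
qed

lemma sum_mult_cnj: "(\<Sum>i\<in>UNIV. v $ i * cnj (v $ i)) = of_real (v \<bullet> v)"
  using cinner_self[of v] by (simp add: cinner_def mult.commute)

lemma mtrace_conj_proj_pt:
  "mtrace (B ** proj_pt v ** cadj B) = of_real ((B *v v) \<bullet> (B *v v) / (v \<bullet> v))"
  by (simp add: mtrace_def conj_proj_pt sum_mult_cnj flip: sum_divide_distrib)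

text \<open>This includes \<open>B *v v = 0\<close>: division by zero yields zero, so both sides are
  the zero matrix.\<close>

lemma pact_proj_pt: "v \<noteq> 0 \<Longrightarrow> pact B (proj_pt v) = proj_pt (B *v v)"
  by (simp add: pact_def vec_eq_iff cscale_def mtrace_conj_proj_pt conj_proj_pt proj_pt_nth)

text \<open>The norm is 1 except at \<open>v = 0\<close>, where it is 0. The uniform bound later
  dominates the integrands.\<close>

lemma norm_proj_pt_le: "norm (proj_pt v) \<le> 1"
proof (cases "v = 0")
  case False
  have "(norm (proj_pt v))\<^sup>2 = (\<Sum>i\<in>UNIV. \<Sum>j\<in>UNIV. (cmod (v $ i))\<^sup>2 * (cmod (v $ j))\<^sup>2) / (v \<bullet> v)\<^sup>2"
    by (simp add: norm_matrix_power2 proj_pt_nth norm_divide norm_mult power_mult_distrib power_divide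
        sum_divide_distrib)
  also have "(\<Sum>i\<in>UNIV. \<Sum>j\<in>UNIV. (cmod (v $ i))\<^sup>2 * (cmod (v $ j))\<^sup>2) = (v \<bullet> v)\<^sup>2"
    by (simp add: power2_eq_square inner_vec_def dot_square_norm flip: sum_product)
  finally have "(norm (proj_pt v))\<^sup>2 = 1" using False by simp
  then show ?thesis by (simp add: abs_square_eq_1)
qed (simp add: norm_vec_def proj_pt_def L2_set_def)

text \<open>Links pairings with points of \<open>projspace\<close> to the Rayleigh quotients of the
  flows.\<close>

lemma inner_proj_pt: "H \<bullet> proj_pt v = (v \<bullet> (H *v v)) / (v \<bullet> v)"
proof -
  have "H \<bullet> proj_pt v = Re (\<Sum>i\<in>UNIV. \<Sum>j\<in>UNIV. cnj (H $ i $ j) * (v $ i * cnj (v $ j) / of_real (v \<bullet> v)))"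
    by (simp add: inner_vec_def inner_complex_eq_Re proj_pt_nth)
  also have "(\<Sum>i\<in>UNIV. \<Sum>j\<in>UNIV. cnj (H $ i $ j) * (v $ i * cnj (v $ j) / of_real (v \<bullet> v)))
      = cinner (H *v v) v / of_real (v \<bullet> v)"
    by (simp add: cinner_def matrix_vector_mult_def sum_divide_distrib sum_distrib_left sum_distrib_right ac_simps)
  also have "Re \<dots> = ((H *v v) \<bullet> v) / (v \<bullet> v)"
    by (simp add: inner_vec_eq_Re_cinner)
  finally show ?thesis by (simp add: inner_commute)
qed

text \<open>Translates the hyperplanes in \<open>admissible\<close>, phrased by projections, into a
  condition on representing vectors.\<close>

lemma proj_pt_mult_vector_nonzero: "proj_pt v *v w \<noteq> 0 \<Longrightarrow> cinner v w \<noteq> 0"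
proof
  assume "proj_pt v *v w \<noteq> 0" "cinner v w = 0"
  moreover have "(proj_pt v *v w) $ i = v $ i * cinner v w / of_real (v \<bullet> v)" for i
    by (simp add: matrix_vector_mult_def proj_pt_nth cinner_def sum_distrib_left sum_divide_distrib ac_simps)
  ultimately show False by (simp add: vec_eq_iff)
qed

lemma pact_scaleR: "c \<noteq> 0 \<Longrightarrow> pact (c *\<^sub>R B) P = pact B P"
  by (simp add: pact_def vec_eq_iff cscale_def cadj_scaleR mm.scaleR_left mm.scaleR_right mtrace_scaleR)
    (simp add: scaleR_conv_of_real[where 'a=complex] field_simps)

lemma tendsto_cadj: "(f \<longlongrightarrow> A) F \<Longrightarrow> ((\<lambda>x. cadj (f x)) \<longlongrightarrow> cadj A) F"
  by (rule bounded_linear.tendsto[OF bounded_linear_cadj])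

text \<open>The condition \<open>B *v v \<noteq> 0\<close> keeps the limiting trace away from zero,
  so the quotient is continuous there.\<close>

lemma tendsto_pact:
  assumes "(f \<longlongrightarrow> B) F" "v \<noteq> 0" "B *v v \<noteq> 0"
  shows "((\<lambda>x. pact (f x) (proj_pt v)) \<longlongrightarrow> pact B (proj_pt v)) F"
  unfolding pact_def
  by (intro cscale_map.tendsto tendsto_intros bounded_linear.tendsto[OF bounded_linear_mtrace]
      mm.tendsto tendsto_cadj assms(1)) (use assms in \<open>simp add: mtrace_conj_proj_pt\<close>)

text \<open>The map may be discontinuous where the trace vanishes, so it is assembled from
  continuous pieces and a measurable division.\<close>

lemma borel_measurable_pact: "pact B \<in> borel_measurable borel"
proof -
  have m: "(\<lambda>P. B ** P ** cadj B) \<in> borel_measurable borel"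
    by (intro borel_measurable_continuous_onI continuous_intros mm.continuous_on)
  have t: "(\<lambda>P. mtrace (B ** P ** cadj B)) \<in> borel_measurable borel"
    by (intro borel_measurable_continuous_onI continuous_intros mm.continuous_on
        bounded_linear.continuous_on[OF bounded_linear_mtrace])
  have "(\<lambda>x. cscale (fst x) (snd x)) \<in> borel_measurable (borel \<Otimes>\<^sub>M borel)"
    by (subst borel_prod) (intro borel_measurable_continuous_onI cscale_map.continuous_on continuous_intros)
  from measurable_compose[OF measurable_Pair[OF borel_measurable_divide[OF measurable_const t] m] this]
  show ?thesis unfolding pact_def[abs_def] by simp
qed

text \<open>For skew-Hermitian \<open>\<xi>\<close> the matrix \<open>cscale (- \<i>) \<xi>\<close>
  is Hermitian, and \<open>Im z\<close> is the real part of \<open>- \<i> * z\<close>.\<close>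

lemma moment_eq_inner:
  assumes "\<xi> \<in> kalg G"
  shows "moment G P \<xi> = cscale (- \<i>) \<xi> \<bullet> P"
proof -
  have "cadj \<xi> = - \<xi>" using assms by (simp add: kalg_def)
  then have skew: "cnj (\<xi> $ i $ j) = - \<xi> $ j $ i" for i j
    by (simp add: cadj_def vec_eq_iff)
  have "cscale (- \<i>) \<xi> \<bullet> P = (\<Sum>i\<in>UNIV. \<Sum>j\<in>UNIV. Im (\<xi> $ j $ i * P $ i $ j))"
    by (simp add: inner_vec_def inner_complex_eq_Re cscale_def skew)
  also have "\<dots> = Im (mtrace (\<xi> ** P))"
    by (subst sum.swap) (simp add: mtrace_def matrix_matrix_mult_def)
  finally show ?thesis using assms by (simp add: moment_def)
qed

section \<open>Hermitian matrices and uniqueness of positive semidefinite square roots\<close>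

lemma linear_matrix_vector_mult: "linear ((*v) (X :: 'n::finite cmat))"
  by (intro bounded_linear.linear mv.bounded_linear_right)

lemma cadj_diff: "cadj (A - B) = cadj A - cadj B"
  by (simp add: linear_diff[OF bounded_linear.linear[OF bounded_linear_cadj]])

lemma hermitian_adj: "cadj H = H \<Longrightarrow> (H *v x) \<bullet> y = x \<bullet> (H *v y)"
  by (simp add: inner_matrix_vector_mult)

lemma hermitian_max_eigenvector:
  fixes H :: "'n::finite cmat"
  assumes "cadj H = H"
  obtains w l where "norm w = 1" "H *v w = l *\<^sub>R w" "\<And>v. v \<bullet> (H *v v) \<le> l * (v \<bullet> v)"
  using self_adjoint_max_eigenvector[OF linear_matrix_vector_mult hermitian_adj[OF assms]] by blast

lemma psd_kernel: "psd B \<Longrightarrow> w \<bullet> (B *v w) = 0 \<Longrightarrow> B *v w = 0"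
  unfolding psd_iff
  by (intro psd_form_kernel[OF linear_matrix_vector_mult] hermitian_adj) auto

text \<open>Let \<open>w\<close> be a top eigenvector of \<open>B - C\<close> with eigenvalue
  \<open>l\<close>. Equality of the norms of \<open>B *v w\<close> and \<open>C *v w\<close> gives
  \<open>l * (w \<bullet> (B *v w) + w \<bullet> (C *v w)) = 0\<close>; if
  \<open>l \<noteq> 0\<close>, both terms vanish and \<open>w\<close> lies in both kernels, which is
  absurd.\<close>

lemma psd_sqrt_mono:
  fixes B C :: "'n::finite cmat"
  assumes "psd B" "psd C" "B ** B = C ** C"
  shows "v \<bullet> (B *v v) \<le> v \<bullet> (C *v v)"
proof -
  have herm: "cadj B = B" "cadj C = C" using assms(1,2) by (auto simp: psd_iff)
  then have "cadj (B - C) = B - C" by (simp add: cadj_diff)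
  then obtain w l where w: "norm w = 1" "(B - C) *v w = l *\<^sub>R w"
    and l: "\<And>v. v \<bullet> ((B - C) *v v) \<le> l * (v \<bullet> v)"
    using hermitian_max_eigenvector by blast
  have "l = 0"
  proof (rule ccontr)
    assume "l \<noteq> 0"
    have w': "B *v w = C *v w + l *\<^sub>R w" using w(2) by (simp add: mv.diff_left algebra_simps)
    have "(B *v w) \<bullet> (B *v w) = (C *v w) \<bullet> (C *v w)"
      using assms(3) by (simp add: hermitian_adj herm matrix_vector_mul_assoc)
    then have "l * (w \<bullet> (B *v w) + w \<bullet> (C *v w)) = 0"
      using w(1) unfolding w' by (simp add: inner_simps inner_commute algebra_simps)
    moreover have "0 \<le> w \<bullet> (B *v w)" "0 \<le> w \<bullet> (C *v w)"
      using assms(1,2) by (auto simp: psd_iff)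
    ultimately have "B *v w = 0" "C *v w = 0"
      using \<open>l \<noteq> 0\<close> by (auto intro!: psd_kernel assms(1,2))
    then show False using w \<open>l \<noteq> 0\<close> by (auto simp: mv.diff_left)
  qed
  then show ?thesis using l[of v] by (simp add: mv.diff_left inner_diff_right)
qed

lemma hermitian_form_zero:
  assumes "cadj H = H" "\<And>v. v \<bullet> (H *v v) = 0"
  shows "H = 0"
proof -
  have "H *v v = 0" for v
    using assms by (intro psd_kernel) (auto simp: psd_iff)
  then show ?thesis by (simp add: matrix_eq)
qed

text \<open>\<open>psd_sqrt_mono\<close> in both directions makes the form of \<open>B - C\<close>
  vanish. This evaluates the \<open>THE\<close> in \<open>msqrt\<close> at squares.\<close>

lemma psd_sqrt_unique:
  assumes "psd B" "psd C" "B ** B = C ** C"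
  shows "B = C"
proof -
  have "B - C = 0"
  proof (rule hermitian_form_zero)
    show "cadj (B - C) = B - C" using assms(1,2) by (simp add: psd_iff cadj_diff)
    show "v \<bullet> ((B - C) *v v) = 0" for v
      using psd_sqrt_mono[OF assms, of v] psd_sqrt_mono[OF assms(2,1) assms(3)[symmetric], of v]
      by (simp add: mv.diff_left inner_diff_right)
  qed
  then show ?thesis by simp
qed

lemma msqrt_square: "psd B \<Longrightarrow> msqrt (B ** B) = B"
  unfolding msqrt_def by (rule the_equality) (auto intro: psd_sqrt_unique)

section \<open>Matrix Lie algebras\<close>

lemma has_vector_derivative_sequentially:
  assumes "(f has_vector_derivative d) (at 0)"
  shows "(\<lambda>n. real n *\<^sub>R (f (1 / real n) - f 0)) \<longlonglongrightarrow> d"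
proof -
  let ?q = "\<lambda>h. (f h - f 0 - h *\<^sub>R d) /\<^sub>R norm h"
  have q: "(?q \<longlongrightarrow> 0) (at 0)"
    using assms by (simp add: has_vector_derivative_def has_derivative_at_within)
  have "filterlim (\<lambda>n. 1 / real n) (at 0) sequentially"
    unfolding filterlim_at using eventually_gt_at_top[of 0]
    by (auto simp: lim_1_over_n elim!: eventually_mono)
  then have "(\<lambda>n. ?q (1 / real n) + d) \<longlonglongrightarrow> 0 + d"
    by (intro tendsto_add filterlim_compose[OF q] tendsto_const)
  moreover have "\<forall>\<^sub>F n in sequentially. ?q (1 / real n) + d = real n *\<^sub>R (f (1 / real n) - f 0)"
    using eventually_gt_at_top[of 0] by eventually_elim (simp add: scaleR_diff_right)
  ultimately show ?thesis by (simp add: tendsto_cong)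
qed

text \<open>Induction by telescoping, with \<open>Z\<close> split as
  \<open>mat 1 + (Z - mat 1)\<close>: the growth factor is then near 1 for \<open>Z\<close> near the
  identity, which \<open>norm Z\<close> need not be.\<close>

lemma mpow_diff_le:
  fixes Z W :: "'n::finite cmat"
  assumes "\<And>j. j < k \<Longrightarrow> norm (mpow W j) \<le> C"
  shows "norm (mpow Z k - mpow W k) \<le> real k * (1 + norm (Z - mat 1)) ^ k * norm (Z - W) * C"
  using assms
proof (induction k)
  case (Suc k)
  let ?a = "norm (Z - mat 1)"
  have C: "C \<ge> 0" using Suc.prems[of 0] norm_ge_zero[of "mpow W 0"] by linarith
  have "mpow Z (Suc k) - mpow W (Suc k)
      = (mpow Z k - mpow W k) + (Z - mat 1) ** (mpow Z k - mpow W k) + (Z - W) ** mpow W k"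
    by (simp add: mm.diff_left mm.diff_right)
  then have "norm (mpow Z (Suc k) - mpow W (Suc k))
      \<le> norm (mpow Z k - mpow W k) + ?a * norm (mpow Z k - mpow W k) + norm (Z - W) * norm (mpow W k)"
    by (smt (verit) norm_matrix_mult_le norm_triangle_ineq)
  also have "\<dots> \<le> (1 + ?a) * norm (mpow Z k - mpow W k) + norm (Z - W) * C"
    using Suc.prems[of k] by (simp add: algebra_simps mult_left_mono mult_right_mono)
  also have "\<dots> \<le> (1 + ?a) * (real k * (1 + ?a) ^ k * norm (Z - W) * C) + (1 + ?a) ^ Suc k * (norm (Z - W) * C)"
    using Suc C mult_right_mono[OF one_le_power[of "1 + ?a" "Suc k"], of "norm (Z - W) * C"]
    by (intro add_mono mult_left_mono) auto
  also have "\<dots> = real (Suc k) * (1 + ?a) ^ Suc k * norm (Z - W) * C"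
    by (simp add: algebra_simps)
  finally show ?case .
qed simp

text \<open>Compare \<open>Z n\<close> with \<open>W n\<close>, whose \<open>n\<close>-th power is
  exactly \<open>mexp X\<close>. Both agree to first order, so \<open>n\<close> times their
  difference tends to 0, while the growth factor in \<open>mpow_diff_le\<close> stays below
  \<open>exp c\<close>.\<close>

lemma mpow_tendsto_mexp:
  fixes X :: "'n::finite cmat"
  assumes Z: "(\<lambda>n. real n *\<^sub>R (Z n - mat 1)) \<longlonglongrightarrow> X"
  shows "(\<lambda>n. mpow (Z n) n) \<longlonglongrightarrow> mexp X"
proof -
  define W where "W n = mexp ((1 / real n) *\<^sub>R X)" for n
  have W: "(\<lambda>n. real n *\<^sub>R (W n - mat 1)) \<longlonglongrightarrow> X"
    using has_vector_derivative_sequentially[OF mexp_has_vector_derivative[of X 0]] by (simp add: W_def)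
  have "continuous_on {0..1} (\<lambda>s. mexp (s *\<^sub>R X))"
    by (rule continuous_on_compose2[OF continuous_on_mexp]) (auto intro!: continuous_intros)
  then have "bounded ((\<lambda>s. mexp (s *\<^sub>R X)) ` {0..1})"
    by (intro compact_imp_bounded compact_continuous_image) auto
  then obtain C where C: "\<And>s. s \<in> {0..1} \<Longrightarrow> norm (mexp (s *\<^sub>R X)) \<le> C"
    unfolding bounded_iff by blast
  obtain c where c: "\<And>n. norm (real n *\<^sub>R (Z n - mat 1)) \<le> c"
    using convergent_imp_Bseq[of "\<lambda>n. real n *\<^sub>R (Z n - mat 1)"] Z
    by (auto simp: convergent_def Bseq_def)
  have bound: "norm (mpow (Z n) n - mexp X) \<le> norm (real n *\<^sub>R (Z n - W n)) * (exp c * C)" if "n > 0" for n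
  proof -
    have "C \<ge> 0" using order_trans[OF norm_ge_zero C[of 0]] by simp
    have "(1 + norm (Z n - mat 1)) ^ n \<le> exp (norm (Z n - mat 1)) ^ n"
      by (intro power_mono) (auto simp: exp_ge_add_one_self)
    also have "\<dots> \<le> exp c"
      using c[of n] by (simp flip: exp_of_nat_mult)
    finally have pow: "(1 + norm (Z n - mat 1)) ^ n \<le> exp c" .
    have Wn: "mpow (W n) n = mexp X"
      unfolding W_def mpow_mexp using that by simp
    have "norm (mpow (W n) j) \<le> C" if "j < n" for j
      unfolding W_def mpow_mexp using that by (intro C) (auto simp: field_simps)
    then have "norm (mpow (Z n) n - mpow (W n) n)
        \<le> real n * (1 + norm (Z n - mat 1)) ^ n * norm (Z n - W n) * C"
      by (rule mpow_diff_le)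
    also have "\<dots> \<le> real n * exp c * norm (Z n - W n) * C"
      by (intro mult_right_mono mult_left_mono pow) (use \<open>C \<ge> 0\<close> in auto)
    finally show ?thesis by (simp add: Wn ac_simps)
  qed
  have "(\<lambda>n. norm (real n *\<^sub>R (Z n - mat 1) - real n *\<^sub>R (W n - mat 1)) * (exp c * C)) \<longlonglongrightarrow> norm (X - X) * (exp c * C)"
    by (intro tendsto_intros Z W)
  then have "(\<lambda>n. norm (real n *\<^sub>R (Z n - W n)) * (exp c * C)) \<longlonglongrightarrow> 0"
    by (simp add: algebra_simps)
  moreover have "\<forall>\<^sub>F n in sequentially. norm (mpow (Z n) n - mexp X) \<le> norm (real n *\<^sub>R (Z n - W n)) * (exp c * C)"
    using eventually_gt_at_top[of 0] by eventually_elim (rule bound)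
  ultimately have "(\<lambda>n. mpow (Z n) n - mexp X) \<longlonglongrightarrow> 0"
    by (rule Lim_null_comparison[rotated])
  then show ?thesis by (simp add: LIM_zero_iff)
qed

text \<open>By the product rule the product of the two one-parameter groups has derivative
  \<open>X + Y\<close> at 0.\<close>

lemma Lie_Trotter: "(\<lambda>n. mpow (mexp ((1 / real n) *\<^sub>R X) ** mexp ((1 / real n) *\<^sub>R Y)) n) \<longlonglongrightarrow> mexp (X + Y)"
proof (rule mpow_tendsto_mexp)
  have "((\<lambda>t. mexp (t *\<^sub>R X) ** mexp (t *\<^sub>R Y)) has_vector_derivative X + Y) (at 0)"
    using mm.has_vector_derivative[OF mexp_has_vector_derivative[of X 0] mexp_has_vector_derivative[of Y 0]]
    by (simp add: add.commute)
  from has_vector_derivative_sequentially[OF this]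
  show "(\<lambda>n. real n *\<^sub>R (mexp ((1 / real n) *\<^sub>R X) ** mexp ((1 / real n) *\<^sub>R Y) - mat 1)) \<longlonglongrightarrow> X + Y"
    by simp
qed

text \<open>Closure under sums is the Trotter formula: its approximants are products in
  \<open>G\<close>, and \<open>G\<close> is closed.\<close>

lemma subspace_lie_alg:
  assumes "mat 1 \<in> G" "\<And>g h. g \<in> G \<Longrightarrow> h \<in> G \<Longrightarrow> g ** h \<in> G" "closed G"
  shows "subspace (lie_alg G)"
proof (rule subspaceI)
  show "0 \<in> lie_alg G" using assms(1) by (simp add: lie_alg_def)
  show "c *\<^sub>R X \<in> lie_alg G" if "X \<in> lie_alg G" for c X
    using that by (simp add: lie_alg_def)
  fix X Y assume XY: "X \<in> lie_alg G" "Y \<in> lie_alg G"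
  have pow: "mpow g n \<in> G" if "g \<in> G" for g n
    using that by (induction n) (auto simp: assms)
  have "mexp (t *\<^sub>R X + t *\<^sub>R Y) \<in> G" for t
    using XY by (intro closed_sequentially[OF assms(3) _ Lie_Trotter] pow assms(2)) (auto simp: lie_alg_def)
  then show "X + Y \<in> lie_alg G" by (simp add: lie_alg_def scaleR_add_right)
qed

section \<open>Hermitian one-parameter groups and the sign of the largest eigenvalue\<close>

lemma self_adjoint_flow_mexp:
  assumes "cadj H = H"
  shows "self_adjoint_flow ((*v) H) (\<lambda>t. mexp (t *\<^sub>R H) *v v)"
proof (rule self_adjoint_flow.intro)
  show "linear ((*v) H)" by (rule linear_matrix_vector_mult)
  show "(H *v x) \<bullet> y = x \<bullet> (H *v y)" for x y by (rule hermitian_adj[OF assms])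
  show "((\<lambda>t. mexp (t *\<^sub>R H) *v v) has_vector_derivative H *v (mexp (t *\<^sub>R H) *v v)) (at t)" for t
    using bounded_linear.has_vector_derivative[OF mv.bounded_linear_left mexp_has_vector_derivative]
    by (simp add: matrix_vector_mul_assoc)
qed

lemma norm_matrix_le_card:
  fixes B :: "'n::finite cmat"
  assumes "\<And>v. norm (B *v v) \<le> norm v"
  shows "norm B \<le> CARD('n)"
proof (rule power2_le_imp_le)
  have "cmod (B $ i $ j) \<le> 1" for i j
  proof -
    have "cmod (B $ i $ j) = cmod ((B *v axis j 1) $ i)"
      by (simp add: matrix_vector_mult_def axis_def if_distrib cong: if_cong)
    also have "\<dots> \<le> norm (B *v axis j 1)" by (rule Finite_Cartesian_Product.norm_nth_le)
    also have "\<dots> \<le> 1" using assms[of "axis j 1"] by (simp add: norm_eq_1 inner_axis_axis)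
    finally show ?thesis .
  qed
  then have "(norm B)\<^sup>2 \<le> (\<Sum>i\<in>(UNIV::'n set). \<Sum>j\<in>(UNIV::'n set). 1)"
    unfolding norm_matrix_power2 by (intro sum_mono) (simp add: abs_square_le_1)
  then show "(norm B)\<^sup>2 \<le> (real CARD('n))\<^sup>2" by (simp add: power2_eq_square)
qed simp

lemma tendsto_det: "(f \<longlongrightarrow> A) F \<Longrightarrow> ((\<lambda>x. det (f x)) \<longlongrightarrow> det (A::'n::finite cmat)) F"
  unfolding det_def by (intro tendsto_intros)

text \<open>If all eigenvalues were nonpositive and one of them negative, a limit point of
  \<open>mexp (n *\<^sub>R H)\<close> would be singular, yet of determinant one.\<close>

lemma max_eigenvalue_pos:
  fixes H :: "'n::finite cmat"
  assumes H: "cadj H = H" "H \<noteq> 0" and det: "\<And>t. det (mexp (t *\<^sub>R H)) = 1"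
    and le: "\<And>v. v \<bullet> (H *v v) \<le> l * (v \<bullet> v)"
  shows "l > 0"
proof (rule ccontr)
  assume "\<not> l > 0"
  then have neg: "v \<bullet> (H *v v) \<le> 0" for v
    using le[of v] by (smt (verit) inner_ge_zero mult_nonneg_nonneg mult_minus_left)
  have "cadj (- H) = - H" using H(1) cadj_scaleR[of "-1" H] by simp
  \<comment> \<open>Applied to \<open>- H\<close>, so \<open>- m\<close> is the least eigenvalue of
    \<open>H\<close>.\<close>
  then obtain w m where w: "norm w = 1" "- H *v w = m *\<^sub>R w" "\<And>v. v \<bullet> (- H *v v) \<le> m * (v \<bullet> v)"
    using hermitian_max_eigenvector by blast
  have "m > 0"
  proof (rule ccontr)
    assume "\<not> m > 0"
    then have "- (v \<bullet> (H *v v)) \<le> 0" for v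
      using w(3)[of v] mult_nonneg_nonneg[of "-m" "v \<bullet> v"] by (simp add: mv.minus_left)
    then have "v \<bullet> (H *v v) = 0" for v
      using neg[of v] by (metis antisym neg_le_0_iff_le)
    then show False using hermitian_form_zero[OF H(1)] H(2) by blast
  qed
  define B where "B n = mexp (real n *\<^sub>R H)" for n
  have Bw: "w \<bullet> (B n *v v) = exp (- m * real n) * (w \<bullet> v)" and nB: "norm (B n *v v) \<le> norm v" for n v
  proof -
    interpret self_adjoint_flow "(*v) H" "\<lambda>t. mexp (t *\<^sub>R H) *v v"
      by (rule self_adjoint_flow_mexp[OF H(1)])
    have "H *v w = - m *\<^sub>R w" using w(2) by (simp add: mv.minus_left) (metis minus_minus)
    from eigen_component[OF this] show "w \<bullet> (B n *v v) = exp (- m * real n) * (w \<bullet> v)"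
      by (simp add: B_def)
    show "norm (B n *v v) \<le> norm v"
      using norm_antimono[OF neg, of 0 "real n"] by (simp add: B_def)
  qed
  have "B n \<in> cball 0 (CARD('n))" for n using norm_matrix_le_card[OF nB] by simp
  then obtain A r where A: "strict_mono r" "(B \<circ> r) \<longlonglongrightarrow> A"
    using compact_cball[of "0::'n cmat" "CARD('n)"] unfolding compact_def by blast
  have "(\<lambda>n. det ((B \<circ> r) n)) \<longlonglongrightarrow> det A" by (rule tendsto_det[OF A(2)])
  then have "det A = 1" by (simp add: B_def det LIMSEQ_const_iff)
  \<comment> \<open>The limit \<open>A\<close> sends \<open>A' *v w\<close> to \<open>w\<close>, yet
    the \<open>w\<close>-components of the approximating images decay to zero.\<close>
  then obtain A' where A': "A ** A' = mat 1"
    using invertible_det_nz[of A] by (auto simp: invertible_def)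
  have AA': "A *v (A' *v w) = w" by (simp add: matrix_vector_mul_assoc A')
  have "(\<lambda>n. w \<bullet> ((B \<circ> r) n *v (A' *v w))) \<longlonglongrightarrow> w \<bullet> (A *v (A' *v w))"
    by (intro tendsto_intros mv.tendsto A(2))
  then have "(\<lambda>n. exp (- m * real (r n)) * (w \<bullet> (A' *v w))) \<longlonglongrightarrow> 1"
    using w(1) by (simp add: Bw AA' dot_square_norm)
  moreover have "(\<lambda>n. exp (- m * real (r n)) * (w \<bullet> (A' *v w))) \<longlonglongrightarrow> 0 * (w \<bullet> (A' *v w))"
  proof (intro tendsto_intros)
    have "(\<lambda>n. exp (- m * real n)) \<longlonglongrightarrow> 0" using \<open>m > 0\<close> by real_asymp
    from LIMSEQ_subseq_LIMSEQ[OF this A(1)] show "(\<lambda>n. exp (- m * real (r n))) \<longlonglongrightarrow> 0"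
      by (simp add: o_def)
  qed
  ultimately show False using LIMSEQ_unique by fastforce
qed

section \<open>Barycentres of admissible measures\<close>

lemma projspace_pact_norm: "P \<in> projspace \<Longrightarrow> norm (pact B P) \<le> 1"
  by (auto simp: projspace_def pact_proj_pt norm_proj_pt_le)

text \<open>The conjugate of a nonzero row of \<open>B\<close> serves as \<open>w\<close>: the
  kernel of \<open>B\<close> lies in the hyperplane orthogonal to it.\<close>

lemma cinner_row_nonzero:
  assumes "B \<noteq> 0"
  obtains w where "w \<noteq> 0" "\<And>v. cinner v w \<noteq> 0 \<Longrightarrow> B *v v \<noteq> 0"
proof -
  obtain i j where ij: "B $ i $ j \<noteq> 0" using assms by (auto simp: vec_eq_iff)
  let ?w = "\<chi> k. cnj (B $ i $ k)"
  have "?w $ j \<noteq> 0" using ij by simp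
  then have "?w \<noteq> 0" by (metis zero_index)
  moreover have "B *v v \<noteq> 0" if "cinner v ?w \<noteq> 0" for v
  proof
    assume "B *v v = 0"
    then have "(B *v v) $ i = 0" by simp
    then have "(\<Sum>k\<in>UNIV. B $ i $ k * v $ k) = 0" by (simp add: matrix_vector_mult_def)
    moreover have "cinner v ?w = cnj (\<Sum>k\<in>UNIV. B $ i $ k * v $ k)"
      by (simp add: cinner_def mult.commute)
    ultimately show False using that by simp
  qed
  ultimately show thesis using that by blast
qed

text \<open>A nonzero Hermitian product may have real part zero; passing to \<open>\<i> *s w\<close>
  exposes its imaginary part and stays in the eigenspace.\<close>

lemma eigenvector_inner_nonzero:
  assumes "norm w = 1" "H *v w = l *\<^sub>R w" "cinner v w \<noteq> 0"
  obtains w' where "norm w' = 1" "H *v w' = l *\<^sub>R w'" "w' \<bullet> v \<noteq> 0"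
proof (cases "w \<bullet> v = 0")
  case True
  let ?w = "\<i> *s w"
  have "cinner v ?w = \<i> * cinner v w"
    by (simp add: cinner_def sum_distrib_left ac_simps)
  then have "v \<bullet> ?w = - Im (cinner v w)"
    by (simp add: inner_vec_eq_Re_cinner)
  then have "?w \<bullet> v = - Im (cinner v w)"
    by (simp only: inner_commute[of ?w v])
  moreover have "Im (cinner v w) \<noteq> 0"
    using assms(3) True inner_vec_eq_Re_cinner[of v w] by (auto simp: inner_commute complex_eq_iff)
  moreover have "H *v ?w = l *\<^sub>R ?w"
  proof -
    have "H *v ?w = \<i> *s (H *v w)"
      by (simp add: vec_eq_iff matrix_vector_mult_def sum_distrib_left ac_simps)
    then show ?thesis by (simp add: assms(2) vec_eq_iff)
  qed
  moreover have "norm ?w = 1" using assms(1) by (simp add: norm_vec_def norm_mult)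
  ultimately show thesis using that[of ?w] by simp
qed (use assms that in blast)

locale admissible_measure = prob_space \<gamma> for \<gamma> :: "'n::finite cmat measure" +
  fixes M :: "'n cmat set"
  assumes sets_borel: "sets \<gamma> = sets borel" and closed_M: "closed M"
    and full: "measure \<gamma> M = 1" and M_proj: "M \<subseteq> projspace" and adm: "admissible M \<gamma>"
begin

definition bary :: "'n cmat \<Rightarrow> 'n cmat" where
  "bary B = (\<integral>P. pact B P \<partial>\<gamma>)"

lemma AE_projspace: "AE P in \<gamma>. P \<in> projspace"
  using AE_prob_1[OF full] by eventually_elim (use M_proj in auto)

text \<open>The hyperplane section is closed, hence measurable, and null by admissibility; outside
  it a point of \<open>M\<close> has a representative not orthogonal to \<open>w\<close>.\<close>

lemma AE_generic:
  assumes "w \<noteq> 0"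
  shows "AE P in \<gamma>. \<exists>v. v \<noteq> 0 \<and> P = proj_pt v \<and> cinner v w \<noteq> 0"
proof -
  have "closed {P :: 'n cmat. P *v w = 0}"
    by (intro closed_Collect_eq mv.continuous_on continuous_on_id continuous_on_const)
  then have "M \<inter> {P. P *v w = 0} \<in> sets \<gamma>"
    by (simp add: sets_borel closed_M closed_Int)
  moreover have "measure \<gamma> (M \<inter> {P. P *v w = 0}) = 0"
    using adm assms by (simp add: admissible_def)
  ultimately have "M \<inter> {P. P *v w = 0} \<in> null_sets \<gamma>"
    by (simp add: null_sets_def emeasure_eq_measure)
  from AE_not_in[OF this] AE_prob_1[OF full] show ?thesis
  proof eventually_elim
    case (elim P)
    then obtain v where "v \<noteq> 0" "P = proj_pt v" using M_proj by (auto simp: projspace_def)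
    then show ?case using elim proj_pt_mult_vector_nonzero[of v w] by auto
  qed
qed

lemma measurable_pact [measurable]: "pact B \<in> borel_measurable \<gamma>"
  using borel_measurable_pact[of B] by (simp add: measurable_cong_sets[OF sets_borel refl])

lemma integrable_pact: "integrable \<gamma> (pact B)"
  by (rule integrable_const_bound[of _ 1])
    (use AE_projspace in \<open>auto intro: projspace_pact_norm elim!: eventually_mono\<close>)

lemma inner_bary: "H \<bullet> bary B = (\<integral>P. H \<bullet> pact B P \<partial>\<gamma>)"
  unfolding bary_def using integrable_pact by (simp add: integral_inner_right)

lemma bary_scaleR: "c \<noteq> 0 \<Longrightarrow> bary (c *\<^sub>R B) = bary B"
  by (simp add: bary_def pact_scaleR)

text \<open>Dominated convergence: pointwise limits can fail only on the kernel of \<open>B\<close>,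
  which sits in a null hyperplane. Singular limits \<open>B\<close> are allowed, which gives
  continuity up to the boundary.\<close>

lemma bary_tendsto:
  assumes "f \<longlonglongrightarrow> B" "B \<noteq> 0"
  shows "(\<lambda>n. bary (f n)) \<longlonglongrightarrow> bary B"
  unfolding bary_def
proof (rule integral_dominated_convergence[where w="\<lambda>_. 1"])
  obtain w where w: "w \<noteq> 0" "\<And>v. cinner v w \<noteq> 0 \<Longrightarrow> B *v v \<noteq> 0"
    using cinner_row_nonzero[OF assms(2)] by blast
  show "AE P in \<gamma>. (\<lambda>n. pact (f n) P) \<longlonglongrightarrow> pact B P"
    using AE_generic[OF w(1)] by eventually_elim (use w(2) assms(1) in \<open>auto intro: tendsto_pact\<close>)
  show "AE P in \<gamma>. norm (pact (f n) P) \<le> 1" for n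
    using AE_projspace by eventually_elim (rule projspace_pact_norm)
qed auto

lemma mexp_nonzero: "mexp (X::'n cmat) \<noteq> 0"
proof
  assume "mexp X = 0"
  then have "(0::'n cmat) = mat 1"
    using mexp_minus_cancel[of 1 X] by (simp add: mm.zero_right)
  then have "(0::'n cmat) $ undefined $ undefined = (mat 1 :: 'n cmat) $ undefined $ undefined" by simp
  then show False by (simp add: mat_def)
qed

context
  fixes H :: "'n cmat"
  assumes herm: "cadj H = H"
begin

lemma inner_pact_mexp:
  assumes "v \<noteq> 0"
  shows "H \<bullet> pact (mexp (t *\<^sub>R H)) (proj_pt v)
    = self_adjoint_flow.rayleigh ((*v) H) (\<lambda>t. mexp (t *\<^sub>R H) *v v) t"
  using assms
  by (simp add: pact_proj_pt inner_proj_pt self_adjoint_flow.rayleigh_def[OF self_adjoint_flow_mexp[OF herm]]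
      mexp_mult_vector_nonzero)

lemma inner_bary_mono:
  assumes "s \<le> t"
  shows "H \<bullet> bary (mexp (s *\<^sub>R H)) \<le> H \<bullet> bary (mexp (t *\<^sub>R H))"
  unfolding inner_bary
proof (rule integral_mono_AE)
  show "AE P in \<gamma>. H \<bullet> pact (mexp (s *\<^sub>R H)) P \<le> H \<bullet> pact (mexp (t *\<^sub>R H)) P"
    using AE_projspace
  proof eventually_elim
    case (elim P)
    then obtain v where "v \<noteq> 0" "P = proj_pt v" by (auto simp: projspace_def)
    then show ?case
      using self_adjoint_flow.rayleigh_mono[OF self_adjoint_flow_mexp[OF herm] mexp_mult_vector_nonzero assms]
      by (simp add: inner_pact_mexp)
  qed
qed (auto intro: integrable_pact)

text \<open>Almost every point has a nonzero component along the top eigenvector, so the integrand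
  tends to \<open>l\<close> by \<open>rayleigh_tendsto\<close>; it is dominated by
  \<open>norm H\<close>.\<close>

lemma inner_bary_tendsto:
  assumes "norm w = 1" "H *v w = l *\<^sub>R w" "\<And>v. v \<bullet> (H *v v) \<le> l * (v \<bullet> v)"
  shows "(\<lambda>n. H \<bullet> bary (mexp (real n *\<^sub>R H))) \<longlonglongrightarrow> l"
proof -
  have "(\<lambda>n. \<integral>P. H \<bullet> pact (mexp (real n *\<^sub>R H)) P \<partial>\<gamma>) \<longlonglongrightarrow> (\<integral>P. l \<partial>\<gamma>)"
  proof (rule integral_dominated_convergence[where w="\<lambda>_. norm H"])
    show "AE P in \<gamma>. norm (H \<bullet> pact (mexp (real n *\<^sub>R H)) P) \<le> norm H" for n
      using AE_projspace
    proof eventually_elim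
      case (elim P)
      have "\<bar>H \<bullet> pact (mexp (real n *\<^sub>R H)) P\<bar> \<le> norm H * norm (pact (mexp (real n *\<^sub>R H)) P)"
        by (rule Cauchy_Schwarz_ineq2)
      also have "\<dots> \<le> norm H * 1" by (intro mult_left_mono projspace_pact_norm elim) simp
      finally show ?case by simp
    qed
    have "w \<noteq> 0" using assms(1) by auto
    show "AE P in \<gamma>. (\<lambda>n. H \<bullet> pact (mexp (real n *\<^sub>R H)) P) \<longlonglongrightarrow> l"
      using AE_generic[OF \<open>w \<noteq> 0\<close>]
    proof eventually_elim
      case (elim P)
      then obtain v where v: "v \<noteq> 0" "P = proj_pt v" "cinner v w \<noteq> 0" by blast
      from eigenvector_inner_nonzero[OF assms(1,2) v(3)]
      obtain w' where w': "norm w' = 1" "H *v w' = l *\<^sub>R w'" "w' \<bullet> v \<noteq> 0" by blast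
      show ?case
        using self_adjoint_flow.rayleigh_tendsto[OF self_adjoint_flow_mexp[OF herm] mexp_mult_vector_nonzero
            w'(2,1) _ assms(3), of v] v w'(3)
        by (simp add: inner_pact_mexp)
    qed
  qed auto
  then show ?thesis by (simp add: inner_bary prob_space)
qed

end

end

section \<open>Surjectivity\<close>

text \<open>Brouwer applied to the projection of \<open>x - W x\<close> onto \<open>C\<close> gives
  a fixed point with \<open>0 \<le> W x \<bullet> (y - x)\<close> on \<open>C\<close>. The outward
  condition excludes the boundary sphere, and at an interior point every direction of
  \<open>S\<close> and its negative may be tested.\<close>

lemma subspace_orthogonal_point:
  fixes W :: "'a::euclidean_space \<Rightarrow> 'a"
  assumes "subspace S" "continuous_on S W" "R > 0"
    and out: "\<And>x. x \<in> S \<Longrightarrow> norm x = R \<Longrightarrow> 0 < x \<bullet> W x"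
  obtains x where "x \<in> S" "\<And>y. y \<in> S \<Longrightarrow> y \<bullet> W x = 0"
proof -
  define C where "C = S \<inter> cball 0 R"
  have "0 \<in> C" using assms(1,3) by (simp add: C_def subspace_0)
  then have C: "closed C" "convex C" "compact C" "C \<noteq> {}" "C \<subseteq> S"
    using assms(1)
    by (auto simp: C_def closed_subspace subspace_imp_convex convex_Int closed_Int_compact)
  obtain x where x: "x \<in> C" and fp: "closest_point C (x - W x) = x"
  proof (rule brouwer[of C "\<lambda>x. closest_point C (x - W x)"])
    show "continuous_on C (\<lambda>x. closest_point C (x - W x))"
      by (rule continuous_on_compose2[OF continuous_on_closest_point[OF C(2,1,4), of UNIV]])
        (auto intro!: continuous_intros continuous_on_subset[OF assms(2) C(5)])
    show "(\<lambda>x. closest_point C (x - W x)) \<in> C \<rightarrow> C"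
      using C by (auto intro: closest_point_in_set)
  qed (use C in auto)
  have var: "0 \<le> W x \<bullet> (y - x)" if "y \<in> C" for y
    using closest_point_dot[OF C(2,1) that, of "x - W x"] by (simp add: fp)
  have "norm x < R"
  proof (rule ccontr)
    assume "\<not> norm x < R"
    then have "norm x = R" using x by (simp add: C_def)
    \<comment> \<open>Testing with \<open>y = 0\<close> gives
      \<open>x \<bullet> W x \<le> 0\<close>.\<close>
    then show False using out[of x] var[OF \<open>0 \<in> C\<close>] x by (simp add: C_def inner_commute)
  qed
  have half: "0 \<le> y \<bullet> W x" if "y \<in> S" for y
  proof -
    define e where "e = (R - norm x) / (norm y + 1)"
    have e: "e > 0" using \<open>norm x < R\<close> by (simp add: e_def add_nonneg_pos)
    have "e * norm y \<le> R - norm x"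
      using \<open>norm x < R\<close> by (simp add: e_def pos_divide_le_eq add_nonneg_pos mult_left_mono)
    then have "norm (x + e *\<^sub>R y) \<le> R"
      using norm_triangle_ineq[of x "e *\<^sub>R y"] e by simp
    then have "x + e *\<^sub>R y \<in> C"
      using x that assms(1) by (simp add: C_def subspace_add subspace_scale)
    from var[OF this] show ?thesis using e by (simp add: inner_commute zero_le_mult_iff)
  qed
  have "y \<bullet> W x = 0" if "y \<in> S" for y
    using half[OF that] half[OF subspace_neg[OF assms(1) that]] by simp
  then show thesis using that x by (auto simp: C_def)
qed

context admissible_measure
begin

text \<open>Otherwise there are counterexamples of every radius \<open>Suc n\<close>; their
  directions accumulate at a unit \<open>U\<close>. Letting \<open>n\<close> and then
  \<open>T\<close> grow gives \<open>l \<le> s * (U \<bullet> Q) \<le> s * l\<close> for the top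
  eigenvalue \<open>l > 0\<close> of \<open>U\<close>, contradicting \<open>s < 1\<close>.\<close>

lemma bary_coercive:
  assumes "subspace S" and herm: "\<And>H. H \<in> S \<Longrightarrow> cadj H = H"
    and det: "\<And>H. H \<in> S \<Longrightarrow> det (mexp H) = 1"
    and Q: "\<And>H l. H \<in> S \<Longrightarrow> (\<And>v. v \<bullet> (H *v v) \<le> l * (v \<bullet> v)) \<Longrightarrow> H \<bullet> Q \<le> l"
    and s: "0 \<le> s" "s < 1"
  shows "\<exists>R>0. \<forall>H\<in>S. norm H = R \<longrightarrow> 0 < H \<bullet> (bary (mexp H) - s *\<^sub>R Q)"
proof (rule ccontr)
  assume "\<not> ?thesis"
  then have "\<exists>H. H \<in> S \<and> norm H = R \<and> H \<bullet> (bary (mexp H) - s *\<^sub>R Q) \<le> 0" if "R > 0" for R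
    using that by (meson not_le)
  then have "\<exists>H. H \<in> S \<and> norm H = real (Suc n) \<and> H \<bullet> (bary (mexp H) - s *\<^sub>R Q) \<le> 0" for n
    by simp
  then obtain h where h: "\<And>n. h n \<in> S" "\<And>n. norm (h n) = real (Suc n)"
    "\<And>n. h n \<bullet> (bary (mexp (h n)) - s *\<^sub>R Q) \<le> 0"
    by metis
  define u where "u n = h n /\<^sub>R real (Suc n)" for n
  have hu: "h n = real (Suc n) *\<^sub>R u n" for n by (simp add: u_def)
  have "compact (S \<inter> sphere 0 1)"
    using assms(1) by (intro closed_Int_compact closed_subspace compact_sphere)
  moreover have uS: "u n \<in> S \<inter> sphere 0 1" for n
    using h(1,2)[of n] assms(1) by (simp add: u_def subspace_scale del: of_nat_Suc)
  ultimately obtain U r where U: "U \<in> S \<inter> sphere 0 1" and r: "strict_mono r" "(u \<circ> r) \<longlonglongrightarrow> U"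
    unfolding compact_def by blast
  have lim: "U \<bullet> bary (mexp (real T *\<^sub>R U)) \<le> s * (U \<bullet> Q)" for T
  proof (rule LIMSEQ_le)
    show "(\<lambda>n. (u \<circ> r) n \<bullet> bary (mexp (real T *\<^sub>R (u \<circ> r) n))) \<longlonglongrightarrow> U \<bullet> bary (mexp (real T *\<^sub>R U))"
      by (intro tendsto_intros bary_tendsto tendsto_mexp r(2) mexp_nonzero)
    show "(\<lambda>n. s * ((u \<circ> r) n \<bullet> Q)) \<longlonglongrightarrow> s * (U \<bullet> Q)"
      by (intro tendsto_intros r(2))
    have "(u \<circ> r) n \<bullet> bary (mexp (real T *\<^sub>R (u \<circ> r) n)) \<le> s * ((u \<circ> r) n \<bullet> Q)" if "T \<le> n" for n
    proof -
      let ?k = "r n"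
      have "T \<le> ?k" using that seq_suble[OF r(1), of n] by simp
      \<comment> \<open>Monotonicity pulls the inequality back from the growing radius to the fixed
        time \<open>T\<close>, where the limit in \<open>n\<close> can be taken.\<close>
      then have "u ?k \<bullet> bary (mexp (real T *\<^sub>R u ?k)) \<le> u ?k \<bullet> bary (mexp (real (Suc ?k) *\<^sub>R u ?k))"
        using uS[of ?k] by (intro inner_bary_mono herm) auto
      moreover have "real (Suc ?k) * (u ?k \<bullet> (bary (mexp (real (Suc ?k) *\<^sub>R u ?k)) - s *\<^sub>R Q)) \<le> 0"
        using h(3)[of ?k] unfolding hu by simp
      then have "u ?k \<bullet> (bary (mexp (real (Suc ?k) *\<^sub>R u ?k)) - s *\<^sub>R Q) \<le> 0"
        by (simp add: mult_le_0_iff del: of_nat_Suc)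
      ultimately show ?thesis by (simp add: inner_diff_right)
    qed
    then show "\<exists>N. \<forall>n\<ge>N. (u \<circ> r) n \<bullet> bary (mexp (real T *\<^sub>R (u \<circ> r) n)) \<le> s * ((u \<circ> r) n \<bullet> Q)"
      by blast
  qed
  have UH: "cadj U = U" "U \<noteq> 0" "U \<in> S" using U herm by auto
  obtain w l where w: "norm w = 1" "U *v w = l *\<^sub>R w" and l: "\<And>v. v \<bullet> (U *v v) \<le> l * (v \<bullet> v)"
    using hermitian_max_eigenvector[OF UH(1)] by blast
  have "l > 0"
    using UH by (intro max_eigenvalue_pos[OF UH(1,2) _ l] det subspace_scale assms(1))
  have "l \<le> s * (U \<bullet> Q)"
    using lim by (intro LIMSEQ_le_const2[OF inner_bary_tendsto[OF UH(1) w l]]) auto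
  also have "\<dots> \<le> s * l" using Q[OF UH(3) l] s by (intro mult_left_mono)
  also have "\<dots> < l" using s \<open>l > 0\<close> by simp
  finally show False by simp
qed

lemma bary_solvable:
  assumes "subspace S" "\<And>H. H \<in> S \<Longrightarrow> cadj H = H" "\<And>H. H \<in> S \<Longrightarrow> det (mexp H) = 1"
    and "\<And>H l. H \<in> S \<Longrightarrow> (\<And>v. v \<bullet> (H *v v) \<le> l * (v \<bullet> v)) \<Longrightarrow> H \<bullet> Q \<le> l"
    and "0 \<le> s" "s < 1"
  obtains H where "H \<in> S" "\<And>K. K \<in> S \<Longrightarrow> K \<bullet> bary (mexp H) = s * (K \<bullet> Q)"
proof -
  obtain R where R: "R > 0" "\<And>H. H \<in> S \<Longrightarrow> norm H = R \<Longrightarrow> 0 < H \<bullet> (bary (mexp H) - s *\<^sub>R Q)"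
    using bary_coercive[OF assms] by blast
  have "continuous_on S (\<lambda>H. bary (mexp H))"
    unfolding continuous_on_sequentially
  proof (intro allI ballI impI)
    fix x a assume "(\<forall>n. x n \<in> S) \<and> x \<longlonglongrightarrow> a"
    then have "(\<lambda>n. mexp (x n)) \<longlonglongrightarrow> mexp a" by (intro tendsto_mexp) simp
    from bary_tendsto[OF this mexp_nonzero] show "((\<lambda>H. bary (mexp H)) \<circ> x) \<longlonglongrightarrow> bary (mexp a)"
      by (simp add: o_def)
  qed
  then have "continuous_on S (\<lambda>H. bary (mexp H) - s *\<^sub>R Q)"
    by (intro continuous_intros)
  from subspace_orthogonal_point[OF assms(1) this R]
  obtain H where "H \<in> S" "\<And>K. K \<in> S \<Longrightarrow> K \<bullet> (bary (mexp H) - s *\<^sub>R Q) = 0" by blast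
  then show thesis using that by (simp add: inner_diff_right)
qed

end

section \<open>Orbit points, the moment hull and limits of positive semidefinite matrices\<close>

lemma closed_orbit_projspace:
  assumes "closed_orbit G M" "\<And>g. g \<in> G \<Longrightarrow> det g = 1"
  shows "M \<subseteq> projspace"
proof
  fix P assume "P \<in> M"
  then obtain g v where g: "g \<in> G" "v \<noteq> 0" "P = pact g (proj_pt v)"
    using assms(1) by (auto simp: closed_orbit_def projspace_def)
  have "g *v v \<noteq> 0"
    using invertible_det_nz[of g] assms(2)[OF g(1)] g(2)
    by (metis invertible_def matrix_vector_mul_assoc matrix_vector_mul_lid mv.zero_right zero_neq_one)
  then show "P \<in> projspace" using g by (auto simp: pact_proj_pt projspace_def)
qed

lemma inner_projspace_le:
  assumes "P \<in> projspace" "\<And>v. v \<bullet> (H *v v) \<le> l * (v \<bullet> v)"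
  shows "H \<bullet> P \<le> l"
  using assms by (auto simp: projspace_def inner_proj_pt divide_le_eq)

text \<open>\<open>Q\<close> combines orbit points with the weights that define
  \<open>\<mu>\<close>; the eigenvalue bound holds at each point and survives convex
  combination.\<close>

lemma moment_hull_barycenter:
  assumes "\<mu> \<in> moment_hull G M" "M \<subseteq> projspace"
  obtains Q where "\<And>\<xi>. \<xi> \<in> kalg G \<Longrightarrow> \<mu> \<xi> = cscale (- \<i>) \<xi> \<bullet> Q" "\<And>\<xi>. \<xi> \<notin> kalg G \<Longrightarrow> \<mu> \<xi> = 0"
    "\<And>H l. (\<And>v. v \<bullet> (H *v v) \<le> l * (v \<bullet> v)) \<Longrightarrow> H \<bullet> Q \<le> l"
proof -
  obtain F c where F: "finite F" "F \<subseteq> moment G ` M" "\<And>f. f \<in> F \<Longrightarrow> c f \<ge> 0" "sum c F = 1"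
    "\<mu> = (\<lambda>x. \<Sum>f\<in>F. c f * f x)"
    using assms(1) unfolding moment_hull_def fconv_hull_def by blast
  have "\<forall>f\<in>F. \<exists>P\<in>M. f = moment G P" using F(2) by blast
  then obtain p where p: "\<And>f. f \<in> F \<Longrightarrow> p f \<in> M" "\<And>f. f \<in> F \<Longrightarrow> f = moment G (p f)" by metis
  define Q where "Q = (\<Sum>f\<in>F. c f *\<^sub>R p f)"
  have \<mu>: "\<mu> \<xi> = (\<Sum>f\<in>F. c f * moment G (p f) \<xi>)" for \<xi>
    unfolding F(5) using p(2) by (intro sum.cong) auto
  show thesis
  proof (rule that[of Q])
    show "\<mu> \<xi> = cscale (- \<i>) \<xi> \<bullet> Q" if "\<xi> \<in> kalg G" for \<xi>
      by (simp add: \<mu> Q_def inner_sum_right moment_eq_inner[OF that])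
    show "\<mu> \<xi> = 0" if "\<xi> \<notin> kalg G" for \<xi>
      using that by (simp add: \<mu> moment_def)
    show "H \<bullet> Q \<le> l" if "\<And>v. v \<bullet> (H *v v) \<le> l * (v \<bullet> v)" for H l
    proof -
      have "H \<bullet> Q = (\<Sum>f\<in>F. c f * (H \<bullet> p f))" by (simp add: Q_def inner_sum_right)
      also have "\<dots> \<le> (\<Sum>f\<in>F. c f * l)"
        using p(1) assms(2) F(3) that by (intro sum_mono mult_left_mono inner_projspace_le) auto
      also have "\<dots> = l" by (simp add: F(4) flip: sum_distrib_right)
      finally show ?thesis .
    qed
  qed
qed

text \<open>Hence scaling a nonzero Hermitian \<open>B\<close> to unit norm is the same as scaling
  its square to trace one, the normalisation in \<open>satake_closure\<close>.\<close>

lemma mtrace_square_hermitian: "cadj B = B \<Longrightarrow> mtrace (B ** B) = of_real ((norm B)\<^sup>2)"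
proof -
  assume "cadj B = B"
  then have "cadj B $ j $ i = B $ j $ i" for i j by simp
  then have "B $ j $ i = cnj (B $ i $ j)" for i j by (simp add: cadj_def)
  then have "(\<Sum>i\<in>UNIV. \<Sum>j\<in>UNIV. B $ i $ j * B $ j $ i) = (\<Sum>i\<in>UNIV. \<Sum>j\<in>UNIV. B $ i $ j * cnj (B $ i $ j))"
    by (intro sum.cong refl arg_cong2[where f="(*)"])
  then have "mtrace (B ** B) = (\<Sum>i\<in>UNIV. \<Sum>j\<in>UNIV. B $ i $ j * cnj (B $ i $ j))"
    by (simp add: mtrace_def matrix_matrix_mult_def)
  then show ?thesis
    by (simp add: norm_matrix_power2 complex_norm_square flip: of_real_power)
qed

lemma tendsto_psd:
  assumes "f \<longlonglongrightarrow> B" "\<And>n. psd (f n)"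
  shows "psd B"
proof -
  have "(\<lambda>n. cadj (f n)) \<longlonglongrightarrow> cadj B" by (rule tendsto_cadj[OF assms(1)])
  moreover have "cadj (f n) = f n" for n using assms(2) by (simp add: psd_iff)
  ultimately have "f \<longlonglongrightarrow> cadj B" by simp
  then have "cadj B = B" using assms(1) by (rule LIMSEQ_unique)
  moreover have "0 \<le> v \<bullet> (B *v v)" for v
    by (rule LIMSEQ_le_const[where X="\<lambda>n. v \<bullet> (f n *v v)"])
      (use assms in \<open>auto simp: psd_iff intro!: tendsto_intros mv.tendsto\<close>)
  ultimately show ?thesis by (simp add: psd_iff)
qed

theorem theorem3p11:
  fixes G M :: "'n::finite cmat set" and \<gamma> :: "'n cmat measure"
  assumes "cx_semisimple_group G"
    and "irreducible_rep G"
    and "closed_orbit G M"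
    and "prob_space \<gamma>" and "sets \<gamma> = sets borel" and "measure \<gamma> M = 1"
    and "admissible M \<gamma>"
  shows "\<forall>\<mu>\<in>moment_hull G M. \<exists>A\<in>satake_closure G. BLY G \<gamma> A = \<mu>"
proof
  fix \<mu> assume \<mu>: "\<mu> \<in> moment_hull G M"
  have G: "mat 1 \<in> G" "\<And>g h. g \<in> G \<Longrightarrow> h \<in> G \<Longrightarrow> g ** h \<in> G" "closed G"
    and det: "\<And>g. g \<in> G \<Longrightarrow> det g = 1"
    and ii: "\<And>X. X \<in> lie_alg G \<Longrightarrow> cscale \<i> X \<in> lie_alg G"
    using assms(1) by (auto simp: cx_semisimple_group_def)
  have Mproj: "M \<subseteq> projspace" by (rule closed_orbit_projspace[OF assms(3) det])
  interpret prob_space \<gamma> by (rule assms(4))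
  interpret admissible_measure \<gamma> M
    by unfold_locales (use assms Mproj in \<open>auto simp: closed_orbit_def\<close>)
  define S where "S = {H \<in> lie_alg G. cadj H = H}"
  have S: "subspace S"
    using subspace_lie_alg[OF G] unfolding S_def subspace_def
    by (auto simp: cadj_scaleR linear_add[OF bounded_linear.linear[OF bounded_linear_cadj]]
        linear_0[OF bounded_linear.linear[OF bounded_linear_cadj]])
  have herm: "cadj H = H" if "H \<in> S" for H using that by (simp add: S_def)
  have exp_G: "mexp H \<in> G" if "H \<in> S" for H
  proof -
    have "mexp (1 *\<^sub>R H) \<in> G" using that unfolding S_def lie_alg_def by blast
    then show ?thesis by simp
  qed
  have k: "cscale (- \<i>) \<xi> \<in> S" if "\<xi> \<in> kalg G" for \<xi>
  proof -
    have \<xi>: "\<xi> \<in> lie_alg G" "cadj \<xi> = - \<xi>" using that by (auto simp: kalg_def)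
    \<comment> \<open>Multiplication by \<open>\<i>\<close> preserves \<open>lie_alg G\<close>, and
      \<open>- \<i>\<close> is its cube.\<close>
    have "cscale (- \<i>) \<xi> = cscale \<i> (cscale \<i> (cscale \<i> \<xi>))"
      by (simp add: cscale_def vec_eq_iff)
    then have "cscale (- \<i>) \<xi> \<in> lie_alg G" using \<xi>(1) ii by simp
    moreover have "cadj (cscale (- \<i>) \<xi>) = cscale \<i> (cadj \<xi>)"
      by (simp add: cscale_def cadj_def vec_eq_iff)
    then have "cadj (cscale (- \<i>) \<xi>) = cscale (- \<i>) \<xi>"
      by (simp add: \<xi>(2) cscale_map.minus_left cscale_map.minus_right)
    ultimately show ?thesis by (simp add: S_def)
  qed
  obtain Q where Q: "\<And>\<xi>. \<xi> \<in> kalg G \<Longrightarrow> \<mu> \<xi> = cscale (- \<i>) \<xi> \<bullet> Q" "\<And>\<xi>. \<xi> \<notin> kalg G \<Longrightarrow> \<mu> \<xi> = 0"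
    "\<And>H l. (\<And>v. v \<bullet> (H *v v) \<le> l * (v \<bullet> v)) \<Longrightarrow> H \<bullet> Q \<le> l"
    using moment_hull_barycenter[OF \<mu> Mproj] by blast
  \<comment> \<open>\<open>Suc n\<close> gives \<open>s 0 = 0\<close> and keeps all values in the
    range \<open>0 \<le> s n < 1\<close> where the equation is solvable.\<close>
  define s where "s n = 1 - 1 / real (Suc n)" for n
  have "\<exists>H\<in>S. \<forall>K\<in>S. K \<bullet> bary (mexp H) = s n * (K \<bullet> Q)" for n
    by (rule bary_solvable[OF S herm det[OF exp_G] Q(3), of "s n"]) (auto simp: s_def)
  then obtain H where H: "\<And>n. H n \<in> S" "\<And>n K. K \<in> S \<Longrightarrow> K \<bullet> bary (mexp (H n)) = s n * (K \<bullet> Q)"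
    by metis
  \<comment> \<open>The \<open>H n\<close> may be unbounded; normalising leaves \<open>bary\<close>
    unchanged and moves the solutions to a compact sphere.\<close>
  define B where "B n = mexp (H n) /\<^sub>R norm (mexp (H n))" for n
  have psd_B: "psd (B n)" for n
    using psd_mexp[OF herm[OF H(1)], of n] by (simp add: B_def psd_iff cadj_scaleR mv.scaleR_left)
  have "B n \<in> sphere 0 1" for n by (simp add: B_def mexp_nonzero)
  then obtain B' r where B': "B' \<in> sphere 0 1" and r: "strict_mono r" "(B \<circ> r) \<longlonglongrightarrow> B'"
    using compact_sphere[of "0::'n cmat" 1] unfolding compact_def by blast
  have "psd B'" by (rule tendsto_psd[OF r(2)]) (simp add: psd_B)
  have eq: "bary (B n) = bary (mexp (H n))" for n
    unfolding B_def by (rule bary_scaleR) (simp add: mexp_nonzero)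
  have K: "K \<bullet> bary B' = K \<bullet> Q" if "K \<in> S" for K
  proof (rule LIMSEQ_unique)
    show "(\<lambda>n. K \<bullet> bary ((B \<circ> r) n)) \<longlonglongrightarrow> K \<bullet> bary B'"
      using B' by (intro tendsto_intros bary_tendsto r(2)) auto
    have "(\<lambda>n. s n * (K \<bullet> Q)) \<longlonglongrightarrow> 1 * (K \<bullet> Q)"
      unfolding s_def by (intro tendsto_intros) (real_asymp simp: field_simps)
    from LIMSEQ_subseq_LIMSEQ[OF this r(1)]
    show "(\<lambda>n. K \<bullet> bary ((B \<circ> r) n)) \<longlonglongrightarrow> K \<bullet> Q"
      by (simp add: o_def eq H(2)[OF that])
  qed
  show "\<exists>A\<in>satake_closure G. BLY G \<gamma> A = \<mu>"
  proof
    show "B' ** B' \<in> satake_closure G"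
      unfolding satake_closure_def closure_sequential
    proof (intro exI conjI allI)
      show "(\<lambda>n. (B \<circ> r) n ** (B \<circ> r) n) \<longlonglongrightarrow> B' ** B'" by (intro mm.tendsto r(2))
      fix n
      let ?g = "mexp (H (r n))"
      have g: "cadj ?g = ?g" using psd_mexp[OF herm[OF H(1)]] by (simp add: psd_iff)
      \<comment> \<open>As \<open>?g\<close> is Hermitian, \<open>?g ** cadj ?g\<close> is its
        square, with trace the squared norm of \<open>?g\<close>.\<close>
      have "(B \<circ> r) n ** (B \<circ> r) n = cscale (1 / mtrace (?g ** cadj ?g)) (?g ** cadj ?g)"
        by (simp add: g mtrace_square_hermitian B_def mm.scaleR_left mm.scaleR_right)
          (simp add: cscale_def vec_eq_iff scaleR_conv_of_real[where 'a=complex] power2_eq_square field_simps)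
      then show "(B \<circ> r) n ** (B \<circ> r) n \<in> {cscale (1 / mtrace (g ** cadj g)) (g ** cadj g) |g. g \<in> G}"
        using exp_G[OF H(1)] by blast
    qed
    show "BLY G \<gamma> (B' ** B') = \<mu>"
    proof
      fix \<xi>
      show "BLY G \<gamma> (B' ** B') \<xi> = \<mu> \<xi>"
      proof (cases "\<xi> \<in> kalg G")
        case True
        \<comment> \<open>Positivity of \<open>B'\<close> makes it the square root used by
          \<open>BLY\<close>; the pairing then falls under \<open>K\<close>.\<close>
        have "BLY G \<gamma> (B' ** B') \<xi> = cscale (- \<i>) \<xi> \<bullet> bary B'"
          by (simp add: BLY_def msqrt_square \<open>psd B'\<close> moment_eq_inner[OF True] inner_bary)
        then show ?thesis using True by (simp add: K k Q(1))
      next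
        case False
        then show ?thesis by (simp add: BLY_def moment_def Q(2))
      qed
    qed
  qed
qed

end
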